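(* Let $(f,Q,\xi,\eta,g)$ be a weak quasi-contact metric structure on a smooth manifold $M^{2n+1}$. Then for all $X\in\mathfrak{X}_M$ the following equalities are true: $$(\nabla_\xi\,h)X=Q^{-1}\big(fX-h^2fX\big)-f R_{X,\xi}\,\xi,$$ $$Q R_{\xi,X}\,\xi-f R_{\xi,fX}\,\xi=2h^2X+(Q+Q^{-1})f^2X .$$
   Context: $\mathfrak{X}_M$ denotes the Lie algebra of smooth vector fields on a smooth manifold $M$ of dimension $2n+1$, and $\nabla$ is the Levi-Civita connection of $g$. The curvature tensor is $R_{X,Y}Z=\nabla_X\nabla_YZ-\nabla_Y\nabla_XZ-\nabla_{[X,Y]}Z$. A weak almost-contact metric structure $(f,Q,\xi,\eta,g)$ on $M^{2n+1}$ consists of a $(1,1)$-tensor $f$, a nonsingular $(1,1)$-tensor $Q$, a vector field $\xi$, a 1-form $\eta$ and a Riemannian metric $g$ such that $f^2=-Q+\eta\otimes\xi$, $\eta(\xi)=1$, $g(fX,fY)=g(X,QY)-\eta(X)\eta(Y)$, $\eta(X)=g(\xi,X)$ for all $X,Y\in\mathfrak{X}_M$. (Then $f\xi=0$, $\eta\circ f=0$, $\eta\circ Q=\eta$, $Q\xi=\xi$, $Qf=fQ$, $f$ is skew-symmetric, $Q$ is self-adjoint and positive definite, and ${\rm rank}\,f=2n$.) The $(1,1)$-tensor $h$ is $h=\frac12\,\mathcal{L}_\xi f$, where $(\mathcal{L}_Z f)X=[Z,fX]-f[Z,X]$. A weak quasi-contact metric structure is a weak almost-contact metric structure satisfying, for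 all $X,Y\in\mathfrak{X}_M$, $$(\nabla_X f)Y+(\nabla_{fX}f)fY=2\,g(X,Y)\,\xi-\eta(Y)\big(X+hX+\eta(X)\,\xi\big).$$ *)

theory Defs
  imports "HOL-Analysis.Analysis" "HOL-Library.Function_Algebras"
begin

section \<open>Functions into a real vector space\<close>

instantiation "fun" :: (type, real_vector) real_vector
begin

definition scaleR_fun :: "real \<Rightarrow> ('a \<Rightarrow> 'b) \<Rightarrow> 'a \<Rightarrow> 'b"
  where "scaleR_fun c f = (\<lambda>x. c *\<^sub>R f x)"

instance
  by standard
    (simp_all add: scaleR_fun_def plus_fun_def fun_eq_iff scaleR_add_right scaleR_add_left)

end

definition scale_by :: "('a \<Rightarrow> real) \<Rightarrow> ('a \<Rightarrow> 'b::real_vector) \<Rightarrow> 'a \<Rightarrow> 'b"  (infixr "\<odot>" 75)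
  where "u \<odot> X = (\<lambda>p. u p *\<^sub>R X p)"

definition linear_on_subspace :: "'a::real_vector set \<Rightarrow> ('a \<Rightarrow> 'b::real_vector) \<Rightarrow> bool"
  where "linear_on_subspace S L \<longleftrightarrow>
    (\<forall>u\<in>S. \<forall>v\<in>S. L (u + v) = L u + L v) \<and> (\<forall>c. \<forall>u\<in>S. L (c *\<^sub>R u) = c *\<^sub>R L u)"


section \<open>Smooth manifolds\<close>

text \<open>The next two notions are meant for open \<open>S\<close> in a finite-dimensional space.\<close>

primrec C_k_on :: "nat \<Rightarrow> 'b::real_normed_vector set \<Rightarrow> ('b \<Rightarrow> 'c::real_normed_vector) \<Rightarrow> bool"
  where
    "C_k_on 0 S F \<longleftrightarrow> continuous_on S F"
  | "C_k_on (Suc k) S F \<longleftrightarrow>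
      (\<forall>x\<in>S. F differentiable at x) \<and> (\<forall>v. C_k_on k S (\<lambda>x. frechet_derivative F (at x) v))"

definition smooth_on :: "'b::real_normed_vector set \<Rightarrow> ('b \<Rightarrow> 'c::real_normed_vector) \<Rightarrow> bool"
  where "smooth_on S F \<longleftrightarrow> (\<forall>k. C_k_on k S F)"

text \<open>The underlying set of a manifold is a whole type \<open>'a\<close>. A chart is a pair \<open>(U, c)\<close> of a
  domain and a coordinate map; \<open>c\<close> is irrelevant outside \<open>U\<close>.\<close>

type_synonym ('a, 'b) chart = "'a set \<times> ('a \<Rightarrow> 'b)"

definition is_chart :: "('a::topological_space, 'b::euclidean_space) chart \<Rightarrow> bool"
  where "is_chart = (\<lambda>(U, c). open U \<and> open (c ` U) \<and> homeomorphism U (c ` U) c (inv_into U c))"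

definition smooth_atlas ::
    "('a::{t2_space, second_countable_topology}, 'b::euclidean_space) chart set \<Rightarrow> bool"
  where "smooth_atlas A \<longleftrightarrow>
    (\<forall>C\<in>A. is_chart C) \<and> (\<Union>(U, c)\<in>A. U) = UNIV \<and>
    (\<forall>(U, c)\<in>A. \<forall>(V, d)\<in>A. smooth_on (c ` (U \<inter> V)) (d \<circ> inv_into U c))"

definition smooth_manifold ::
    "nat \<Rightarrow> ('a::{t2_space, second_countable_topology}, 'b::euclidean_space) chart set \<Rightarrow> bool"
  where "smooth_manifold m A \<longleftrightarrow> smooth_atlas A \<and> DIM('b) = m"

definition smooth_fun_on ::
    "('a::topological_space, 'b::euclidean_space) chart set \<Rightarrow> 'a set \<Rightarrow> ('a \<Rightarrow> real) \<Rightarrow> bool"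
  where "smooth_fun_on A W \<phi> \<longleftrightarrow> (\<forall>(U, c)\<in>A. smooth_on (c ` (U \<inter> W)) (\<phi> \<circ> inv_into U c))"

definition smooth_near ::
    "('a::topological_space, 'b::euclidean_space) chart set \<Rightarrow> 'a \<Rightarrow> ('a \<Rightarrow> real) \<Rightarrow> bool"
  where "smooth_near A p \<phi> \<longleftrightarrow> (\<exists>W. open W \<and> p \<in> W \<and> smooth_fun_on A W \<phi>)"


section \<open>Tangent vectors and vector fields\<close>

text \<open>A tangent vector at \<open>p\<close> is a directional derivative operator
  \<open>\<phi> \<mapsto> \<Sum>\<^sub>i w\<^sup>i \<partial>\<phi>/\<partial>x\<^sup>i\<close> acting on the functions that are smooth near \<open>p\<close>. It is
  extended by \<open>0\<close> to all other functions, so that equality of tangent vectors is equality in HOL.\<close>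

type_synonym 'a tangent = "('a \<Rightarrow> real) \<Rightarrow> real"

definition chart_derivative ::
    "('a::topological_space, 'b::euclidean_space) chart set \<Rightarrow> ('a, 'b) chart \<Rightarrow> 'a \<Rightarrow> 'b \<Rightarrow> 'a tangent"
  where "chart_derivative A = (\<lambda>(U, c) p w \<phi>.
    if smooth_near A p \<phi> then frechet_derivative (\<phi> \<circ> inv_into U c) (at (c p)) w else 0)"

definition tangent_space ::
    "('a::topological_space, 'b::euclidean_space) chart set \<Rightarrow> 'a \<Rightarrow> 'a tangent set"
  where "tangent_space A p = {chart_derivative A (U, c) p w | U c w. (U, c) \<in> A \<and> p \<in> U}"

type_synonym 'a vfield = "'a \<Rightarrow> 'a tangent"

definition vector_fields ::
    "('a::topological_space, 'b::euclidean_space) chart set \<Rightarrow> 'a vfield set"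
  where "vector_fields A = {X. (\<forall>p. X p \<in> tangent_space A p) \<and>
    (\<forall>W \<phi>. open W \<and> smooth_fun_on A W \<phi> \<longrightarrow> smooth_fun_on A W (\<lambda>p. X p \<phi>))}"

definition lie_bracket ::
    "('a::topological_space, 'b::euclidean_space) chart set \<Rightarrow> 'a vfield \<Rightarrow> 'a vfield \<Rightarrow> 'a vfield"
  where "lie_bracket A X Y = (\<lambda>p \<phi>.
    if smooth_near A p \<phi> then X p (\<lambda>q. Y q \<phi>) - Y p (\<lambda>q. X q \<phi>) else 0)"


section \<open>Tensor fields\<close>

text \<open>Tensor fields are families of (multi)linear maps on the tangent spaces. Smoothness is tested on
  smooth vector fields. Values outside the tangent spaces are irrelevant.\<close>

type_synonym 'a tensor11 = "'a \<Rightarrow> 'a tangent \<Rightarrow> 'a tangent"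
type_synonym 'a form1 = "'a \<Rightarrow> 'a tangent \<Rightarrow> real"
type_synonym 'a tensor02 = "'a \<Rightarrow> 'a tangent \<Rightarrow> 'a tangent \<Rightarrow> real"

text \<open>The action of a (1,1)-tensor, or of a 1-form, on a vector field.\<close>

definition act :: "('a \<Rightarrow> 'a tangent \<Rightarrow> 'c) \<Rightarrow> 'a vfield \<Rightarrow> 'a \<Rightarrow> 'c"  (infixr "\<cdot>" 80)
  where "T \<cdot> X = (\<lambda>p. T p (X p))"

definition is_tensor11 ::
    "('a::topological_space, 'b::euclidean_space) chart set \<Rightarrow> 'a tensor11 \<Rightarrow> bool"
  where "is_tensor11 A T \<longleftrightarrow>
    (\<forall>p. linear_on_subspace (tangent_space A p) (T p) \<and>
         T p ` tangent_space A p \<subseteq> tangent_space A p) \<and>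
    (\<forall>X\<in>vector_fields A. T \<cdot> X \<in> vector_fields A)"

definition is_form1 ::
    "('a::topological_space, 'b::euclidean_space) chart set \<Rightarrow> 'a form1 \<Rightarrow> bool"
  where "is_form1 A \<omega> \<longleftrightarrow>
    (\<forall>p. linear_on_subspace (tangent_space A p) (\<omega> p)) \<and>
    (\<forall>X\<in>vector_fields A. smooth_fun_on A UNIV (\<omega> \<cdot> X))"

definition metric_fun :: "'a tensor02 \<Rightarrow> 'a vfield \<Rightarrow> 'a vfield \<Rightarrow> 'a \<Rightarrow> real"
  where "metric_fun g X Y = (\<lambda>p. g p (X p) (Y p))"

definition riemannian_metric ::
    "('a::topological_space, 'b::euclidean_space) chart set \<Rightarrow> 'a tensor02 \<Rightarrow> bool"
  where "riemannian_metric A g \<longleftrightarrow>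
    (\<forall>p. \<forall>u\<in>tangent_space A p.
        linear_on_subspace (tangent_space A p) (g p u) \<and>
        (\<forall>v\<in>tangent_space A p. g p u v = g p v u) \<and>
        (u \<noteq> 0 \<longrightarrow> g p u u > 0)) \<and>
    (\<forall>X\<in>vector_fields A. \<forall>Y\<in>vector_fields A. smooth_fun_on A UNIV (metric_fun g X Y))"

definition nonsingular ::
    "('a::topological_space, 'b::euclidean_space) chart set \<Rightarrow> 'a tensor11 \<Rightarrow> bool"
  where "nonsingular A T \<longleftrightarrow>
    (\<forall>p. bij_betw (T p) (tangent_space A p) (tangent_space A p))"

definition tensor_inv ::
    "('a::topological_space, 'b::euclidean_space) chart set \<Rightarrow> 'a tensor11 \<Rightarrow> 'a tensor11"
  where "tensor_inv A T = (\<lambda>p. inv_into (tangent_space A p) (T p))"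


section \<open>Connections\<close>

definition affine_connection ::
    "('a::topological_space, 'b::euclidean_space) chart set \<Rightarrow> ('a vfield \<Rightarrow> 'a vfield \<Rightarrow> 'a vfield) \<Rightarrow> bool"
  where "affine_connection A nabla \<longleftrightarrow>
    (\<forall>X\<in>vector_fields A. \<forall>Y\<in>vector_fields A. nabla X Y \<in> vector_fields A) \<and>
    (\<forall>X\<in>vector_fields A. \<forall>Y\<in>vector_fields A. \<forall>Z\<in>vector_fields A.
        nabla (X + Y) Z = nabla X Z + nabla Y Z \<and> nabla X (Y + Z) = nabla X Y + nabla X Z) \<and>
    (\<forall>u. \<forall>X\<in>vector_fields A. \<forall>Y\<in>vector_fields A. smooth_fun_on A UNIV u \<longrightarrow>
        nabla (u \<odot> X) Y = u \<odot> nabla X Y \<and>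
        nabla X (u \<odot> Y) = u \<odot> nabla X Y + (\<lambda>p. X p u) \<odot> Y)"

definition levi_civita ::
    "('a::topological_space, 'b::euclidean_space) chart set \<Rightarrow> 'a tensor02 \<Rightarrow>
      ('a vfield \<Rightarrow> 'a vfield \<Rightarrow> 'a vfield) \<Rightarrow> bool"
  where "levi_civita A g nabla \<longleftrightarrow>
    affine_connection A nabla \<and>
    (\<forall>X\<in>vector_fields A. \<forall>Y\<in>vector_fields A. nabla X Y - nabla Y X = lie_bracket A X Y) \<and>
    (\<forall>X\<in>vector_fields A. \<forall>Y\<in>vector_fields A. \<forall>Z\<in>vector_fields A. \<forall>p.
        X p (metric_fun g Y Z) = metric_fun g (nabla X Y) Z p + metric_fun g Y (nabla X Z) p)"

text \<open>In the next two definitions a (1,1)-tensor enters as an operator on vector fields.\<close>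

definition cov_deriv ::
    "('a vfield \<Rightarrow> 'a vfield \<Rightarrow> 'a vfield) \<Rightarrow> 'a vfield \<Rightarrow> ('a vfield \<Rightarrow> 'a vfield) \<Rightarrow> 'a vfield \<Rightarrow> 'a vfield"
  where "cov_deriv nabla X T Y = nabla X (T Y) - T (nabla X Y)"

definition lie_deriv ::
    "('a::topological_space, 'b::euclidean_space) chart set \<Rightarrow> 'a vfield \<Rightarrow>
      ('a vfield \<Rightarrow> 'a vfield) \<Rightarrow> 'a vfield \<Rightarrow> 'a vfield"
  where "lie_deriv A Z T X = lie_bracket A Z (T X) - T (lie_bracket A Z X)"

definition curvature ::
    "('a::topological_space, 'b::euclidean_space) chart set \<Rightarrow>
      ('a vfield \<Rightarrow> 'a vfield \<Rightarrow> 'a vfield) \<Rightarrow> 'a vfield \<Rightarrow> 'a vfield \<Rightarrow> 'a vfield \<Rightarrow> 'a vfield"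
  where "curvature A nabla X Y Z = nabla X (nabla Y Z) - nabla Y (nabla X Z) - nabla (lie_bracket A X Y) Z"


section \<open>Weak quasi-contact metric structures\<close>

definition weak_almost_contact_metric ::
    "('a::topological_space, 'b::euclidean_space) chart set \<Rightarrow> 'a tensor11 \<Rightarrow> 'a tensor11 \<Rightarrow>
      'a vfield \<Rightarrow> 'a form1 \<Rightarrow> 'a tensor02 \<Rightarrow> bool"
  where "weak_almost_contact_metric A f Q \<xi> \<eta> g \<longleftrightarrow>
    is_tensor11 A f \<and> is_tensor11 A Q \<and> nonsingular A Q \<and>
    \<xi> \<in> vector_fields A \<and> is_form1 A \<eta> \<and> riemannian_metric A g \<and>
    (\<forall>p. \<eta> p (\<xi> p) = 1) \<and>
    (\<forall>p. \<forall>u\<in>tangent_space A p.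
        f p (f p u) = - Q p u + \<eta> p u *\<^sub>R \<xi> p \<and>
        \<eta> p u = g p (\<xi> p) u \<and>
        (\<forall>v\<in>tangent_space A p. g p (f p u) (f p v) = g p u (Q p v) - \<eta> p u * \<eta> p v))"

definition tensor_h ::
    "('a::topological_space, 'b::euclidean_space) chart set \<Rightarrow> 'a tensor11 \<Rightarrow> 'a vfield \<Rightarrow>
      'a vfield \<Rightarrow> 'a vfield"
  where "tensor_h A f \<xi> X = (1/2) *\<^sub>R lie_deriv A \<xi> (act f) X"

definition weak_quasi_contact_metric ::
    "('a::topological_space, 'b::euclidean_space) chart set \<Rightarrow> ('a vfield \<Rightarrow> 'a vfield \<Rightarrow> 'a vfield) \<Rightarrow>
      'a tensor11 \<Rightarrow> 'a tensor11 \<Rightarrow> 'a vfield \<Rightarrow> 'a form1 \<Rightarrow> 'a tensor02 \<Rightarrow> bool"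
  where "weak_quasi_contact_metric A nabla f Q \<xi> \<eta> g \<longleftrightarrow>
    weak_almost_contact_metric A f Q \<xi> \<eta> g \<and> levi_civita A g nabla \<and>
    (\<forall>X\<in>vector_fields A. \<forall>Y\<in>vector_fields A.
        cov_deriv nabla X (act f) Y + cov_deriv nabla (f \<cdot> X) (act f) (f \<cdot> Y) =
          (2 *\<^sub>R metric_fun g X Y) \<odot> \<xi> - (\<eta> \<cdot> Y) \<odot> (X + tensor_h A f \<xi> X + (\<eta> \<cdot> X) \<odot> \<xi>))"

end

theory Submission
  imports Defs
begin

text \<open>
  Write \<open>E X = \<eta>(X) \<xi>\<close>. The identities rest on two facts that the contact condition
  \<open>(\<nabla>\<^sub>X f) Y + (\<nabla>\<^bsub>fX\<^esub> f) fY = 2 g(X,Y) \<xi> - \<eta>(Y) (X + h X + E X)\<close>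
  imposes on the algebraic data: \<open>f \<xi> = 0\<close>, and \<open>Q\<close> acts as the identity on vector fields.

  The first fact, \<open>f \<xi> = 0\<close> (lemma \<open>f_xi\<close>), is not a consequence of the pointwise axioms. They make
  \<open>f\<close> skew-symmetric (\<open>f_skew\<close>), so in odd dimension \<open>f\<close> has a kernel, but they allow the kernel to
  be oblique to \<open>\<xi>\<close>. If a vector field \<open>V\<close> satisfies \<open>f V = 0\<close>, the contact condition with
  \<open>X = Y = V\<close>, paired with \<open>V\<close>, yields \<open>|V|\<^sup>2 = \<eta>(V)\<^sup>2\<close>, which forces \<open>V = \<eta>(V) \<xi>\<close>
  (\<open>annihilated_field_parallel\<close>); hence \<open>f \<xi> = 0\<close> wherever \<open>V \<noteq> 0\<close>. Such a \<open>V\<close> is the part of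
  \<open>\<xi>\<close> orthogonal to the iterates \<open>f\<^sup>2 \<xi>, f\<^sup>4 \<xi>, \<dots>\<close>. A Gram-Schmidt process without divisions
  produces it as a globally smooth field, so that no local frames or cut-off functions are involved.
  That \<open>V\<close> does not vanish is where the odd dimension enters.

  Once \<open>f \<xi> = 0\<close>, the choices \<open>X = \<xi>\<close> and \<open>Y = \<xi>\<close> in the contact condition give
  \<open>\<nabla>\<^sub>\<xi> f = 0\<close> and \<open>f \<nabla>\<^sub>X \<xi> = X + h X - E X\<close>. With the definition of \<open>h\<close> this implies
  \<open>\<nabla>\<^sub>\<xi> \<xi> = 0\<close>, \<open>\<nabla>\<^bsub>fX\<^esub> \<xi> = X - h X - E X\<close> and \<open>f h = - h f\<close>. Pairing the contact condition with
  \<open>\<xi>\<close> then shows \<open>Q (X - h X) = X - h X\<close>; together with the same for \<open>f X\<close> and the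
  anticommutation this gives \<open>Q X = X\<close> (\<open>Q_fixes_fields\<close>), so \<open>Q\<close> and its inverse disappear from
  both identities. The first identity is the formula for \<open>R\<^bsub>X,\<xi>\<^esub> \<xi>\<close> with \<open>f\<close> moved through
  \<open>\<nabla>\<^sub>\<xi>\<close> (\<open>cov_deriv_h\<close>). The second is obtained by applying \<open>f\<close> to the first and adding the
  first for \<open>f X\<close>: the terms with \<open>\<nabla>\<^sub>\<xi> h\<close> cancel, because \<open>f h + h f = 0\<close> and \<open>f\<close> is parallel
  along \<open>\<xi>\<close> (\<open>jacobi_operator_relation\<close>).
\<close>

section \<open>Calculus of smooth functions\<close>

lemma C_k_on_subset: "C_k_on k S F \<Longrightarrow> T \<subseteq> S \<Longrightarrow> C_k_on k T F"
  by (induction k arbitrary: F) (auto intro: continuous_on_subset)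

text \<open>A derivative at a point of an open set depends only on the values on that set. This lets the
  derivative functions in the inductions below be replaced by explicit formulas.\<close>

lemma C_k_on_cong:
  assumes "open S" "\<And>x. x \<in> S \<Longrightarrow> F x = G x"
  shows "C_k_on k S F \<longleftrightarrow> C_k_on k S G"
  using assms(2)
proof (induction k arbitrary: F G)
  case 0
  then show ?case by (simp cong: continuous_on_cong)
next
  case (Suc k)
  have der: "(F has_derivative D) (at x) \<longleftrightarrow> (G has_derivative D) (at x)" if "x \<in> S" for x D
    using has_derivative_transform_within_open[OF _ assms(1) that, of F D UNIV G]
      has_derivative_transform_within_open[OF _ assms(1) that, of G D UNIV F] Suc.prems
    by auto
  then have "frechet_derivative F (at x) v = frechet_derivative G (at x) v" if "x \<in> S" for x v
    using that by (simp add: frechet_derivative_def)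
  then have "C_k_on k S (\<lambda>x. frechet_derivative F (at x) v)
      \<longleftrightarrow> C_k_on k S (\<lambda>x. frechet_derivative G (at x) v)" for v
    by (rule Suc.IH)
  moreover have "F differentiable at x \<longleftrightarrow> G differentiable at x" if "x \<in> S" for x
    using der[OF that] by (simp add: differentiable_def)
  ultimately show ?case by simp
qed

lemma C_k_on_Suc_imp: "C_k_on (Suc k) S F \<Longrightarrow> C_k_on k S F"
proof (induction k arbitrary: F)
  case 0
  then show ?case
    by (auto intro!: continuous_at_imp_continuous_on differentiable_imp_continuous_within)
next
  case (Suc k)
  then show ?case by (simp del: C_k_on.simps(1))
qed

lemma C_k_on_const: "C_k_on k S (\<lambda>x. c)"
  by (induction k arbitrary: c) auto

lemma C_k_on_add:
  assumes "open S" "C_k_on k S F" "C_k_on k S G"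
  shows "C_k_on k S (\<lambda>x. F x + G x)"
  using assms(2,3)
proof (induction k arbitrary: F G)
  case 0
  then show ?case by (auto intro: continuous_intros)
next
  case (Suc k)
  have d: "((\<lambda>x. F x + G x) has_derivative
      (\<lambda>v. frechet_derivative F (at x) v + frechet_derivative G (at x) v)) (at x)"
    if "x \<in> S" for x
    using Suc.prems that by (auto intro!: has_derivative_add simp flip: frechet_derivative_works)
  then have "C_k_on k S (\<lambda>x. frechet_derivative (\<lambda>x. F x + G x) (at x) v)" for v
    using Suc C_k_on_cong[OF assms(1), of "\<lambda>x. frechet_derivative (\<lambda>x. F x + G x) (at x) v"
        "\<lambda>x. frechet_derivative F (at x) v + frechet_derivative G (at x) v" k]
    by (simp flip: frechet_derivative_at[OF d])
  then show ?case using Suc.prems by simp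
qed

lemma C_k_on_bounded_linear:
  assumes "open S" "bounded_linear L" "C_k_on k S F"
  shows "C_k_on k S (\<lambda>x. L (F x))"
  using assms(3)
proof (induction k arbitrary: F)
  case 0
  then show ?case using assms(2) by (auto intro: bounded_linear.continuous_on)
next
  case (Suc k)
  have d: "((\<lambda>x. L (F x)) has_derivative (\<lambda>v. L (frechet_derivative F (at x) v))) (at x)"
    if "x \<in> S" for x
    using Suc.prems that
    by (auto intro!: bounded_linear.has_derivative[OF assms(2)] simp: frechet_derivative_works)
  then have "C_k_on k S (\<lambda>x. frechet_derivative (\<lambda>x. L (F x)) (at x) v)" for v
    using Suc C_k_on_cong[OF assms(1), of "\<lambda>x. frechet_derivative (\<lambda>x. L (F x)) (at x) v"
        "\<lambda>x. L (frechet_derivative F (at x) v)" k]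
    by (simp flip: frechet_derivative_at[OF d])
  moreover have "(\<lambda>x. L (F x)) differentiable at x" if "x \<in> S" for x
    using d[OF that] by (auto simp: differentiable_def)
  ultimately show ?case by simp
qed

lemma C_k_on_mult:
  fixes F G :: "'b::real_normed_vector \<Rightarrow> real"
  assumes "open S" "C_k_on k S F" "C_k_on k S G"
  shows "C_k_on k S (\<lambda>x. F x * G x)"
  using assms(2,3)
proof (induction k arbitrary: F G)
  case 0
  then show ?case by (auto intro: continuous_intros)
next
  case (Suc k)
  have d: "((\<lambda>x. F x * G x) has_derivative
      (\<lambda>v. F x * frechet_derivative G (at x) v + frechet_derivative F (at x) v * G x)) (at x)"
    if "x \<in> S" for x
    using Suc.prems that by (auto intro!: has_derivative_mult simp flip: frechet_derivative_works)
  have "C_k_on k S (\<lambda>x. F x * frechet_derivative G (at x) v + frechet_derivative F (at x) v * G x)"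
    for v
    using Suc.prems
    by (intro C_k_on_add[OF assms(1)] Suc.IH)
      (simp_all add: C_k_on_Suc_imp del: C_k_on.simps, simp_all)
  then have "C_k_on k S (\<lambda>x. frechet_derivative (\<lambda>x. F x * G x) (at x) v)" for v
    using C_k_on_cong[OF assms(1), of "\<lambda>x. frechet_derivative (\<lambda>x. F x * G x) (at x) v"
        "\<lambda>x. F x * frechet_derivative G (at x) v + frechet_derivative F (at x) v * G x" k]
    by (simp flip: frechet_derivative_at[OF d])
  then show ?case using Suc.prems by simp
qed

section \<open>Charts and tangent spaces\<close>

context
  fixes A :: "('a::{t2_space, second_countable_topology}, 'b::euclidean_space) chart set"
  assumes atlas: "smooth_atlas A"
begin

lemma chart_facts:
  assumes "(U, c) \<in> A"
  shows "open U" "inj_on c U" "\<And>W. open W \<Longrightarrow> open (c ` (U \<inter> W))"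
proof -
  have ch: "open U" "open (c ` U)" and hom: "homeomorphism U (c ` U) c (inv_into U c)"
    using atlas assms by (auto simp: smooth_atlas_def is_chart_def)
  show "open U" by fact
  show "inj_on c U" using hom by (metis homeomorphism_def inj_on_inverseI)
  show "open (c ` (U \<inter> W))" if "open W" for W
    using homeomorphism_imp_open_map[OF hom, of "U \<inter> W"] that ch
    by (auto simp: openin_open_eq)
qed

lemma chart_exists: obtains U c where "(U, c) \<in> A" "p \<in> U"
proof -
  have "p \<in> (\<Union>(U, c)\<in>A. U)" using atlas by (simp add: smooth_atlas_def)
  then show thesis using that by auto
qed

lemma chart_transition_C_k:
  assumes "(U, c) \<in> A" "(V, d) \<in> A"
  shows "C_k_on k (c ` (U \<inter> V)) (d \<circ> inv_into U c)"
proof -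
  have "\<forall>(U, c)\<in>A. \<forall>(V, d)\<in>A. smooth_on (c ` (U \<inter> V)) (d \<circ> inv_into U c)"
    using atlas by (simp add: smooth_atlas_def)
  then have "smooth_on (c ` (U \<inter> V)) (d \<circ> inv_into U c)" using assms by fast
  then show ?thesis by (simp add: smooth_on_def)
qed

lemma smooth_fun_on_const: "smooth_fun_on A W (\<lambda>p. r)"
  by (auto simp: smooth_fun_on_def smooth_on_def o_def C_k_on_const)

lemma smooth_fun_on_add:
  assumes "open W" "smooth_fun_on A W \<phi>" "smooth_fun_on A W \<psi>"
  shows "smooth_fun_on A W (\<lambda>p. \<phi> p + \<psi> p)"
  using assms by (fastforce simp: smooth_fun_on_def smooth_on_def o_def
      intro: C_k_on_add chart_facts(3))

lemma smooth_fun_on_mult: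
  assumes "open W" "smooth_fun_on A W \<phi>" "smooth_fun_on A W \<psi>"
  shows "smooth_fun_on A W (\<lambda>p. \<phi> p * \<psi> p)"
  using assms by (fastforce simp: smooth_fun_on_def smooth_on_def o_def
      intro: C_k_on_mult chart_facts(3))

lemma smooth_fun_on_subset: "smooth_fun_on A W \<phi> \<Longrightarrow> W' \<subseteq> W \<Longrightarrow> smooth_fun_on A W' \<phi>"
  unfolding smooth_fun_on_def smooth_on_def
  by (fast intro: C_k_on_subset)

lemma smooth_fun_on_C_k:
  "smooth_fun_on A W \<phi> \<Longrightarrow> (U, c) \<in> A \<Longrightarrow> C_k_on k (c ` (U \<inter> W)) (\<phi> \<circ> inv_into U c)"
  by (auto simp: smooth_fun_on_def smooth_on_def)

lemma smooth_near_differentiable: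
  assumes "smooth_near A p \<phi>" "(U, c) \<in> A" "p \<in> U"
  shows "(\<phi> \<circ> inv_into U c) differentiable at (c p)"
proof -
  obtain W where "p \<in> W" "smooth_fun_on A W \<phi>" using assms(1) by (auto simp: smooth_near_def)
  then have "C_k_on (Suc 0) (c ` (U \<inter> W)) (\<phi> \<circ> inv_into U c)"
    using assms(2) by (intro smooth_fun_on_C_k)
  then show ?thesis using \<open>p \<in> W\<close> assms(3) by simp
qed

lemma linear_chart_derivative:
  assumes "(U, c) \<in> A" "p \<in> U"
  shows "linear (chart_derivative A (U, c) p)"
proof -
  have "linear (frechet_derivative (\<phi> \<circ> inv_into U c) (at (c p)))" if "smooth_near A p \<phi>" for \<phi>
    using smooth_near_differentiable[OF that assms] by (rule linear_frechet_derivative)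
  then show ?thesis
    by (intro linearI)
      (auto simp: chart_derivative_def fun_eq_iff scaleR_fun_def linear_add linear_scale)
qed

text \<open>The chain rule: components transform by the derivative of the transition map. Hence a single
  chart around \<open>p\<close> parametrizes the whole tangent space, which makes it a vector space.\<close>

lemma chart_derivative_change:
  assumes "(U, c) \<in> A" "p \<in> U" "(V, d) \<in> A" "p \<in> V"
  shows "chart_derivative A (U, c) p w =
    chart_derivative A (V, d) p (frechet_derivative (d \<circ> inv_into U c) (at (c p)) w)"
proof
  fix \<phi>
  let ?T = "d \<circ> inv_into U c"
  have "C_k_on (Suc 0) (c ` (U \<inter> V)) ?T"
    using assms by (intro chart_transition_C_k)
  then have T: "(?T has_derivative frechet_derivative ?T (at (c p))) (at (c p))"
    using assms by (simp flip: frechet_derivative_works)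
  have Tp: "?T (c p) = d p" using assms chart_facts(2) by simp
  show "chart_derivative A (U, c) p w \<phi> =
    chart_derivative A (V, d) p (frechet_derivative ?T (at (c p)) w) \<phi>"
  proof (cases "smooth_near A p \<phi>")
    case True
    have "(\<phi> \<circ> inv_into V d has_derivative frechet_derivative (\<phi> \<circ> inv_into V d) (at (d p)))
        (at (d p))"
      using smooth_near_differentiable[OF True assms(3,4)] by (simp add: frechet_derivative_works)
    then have "((\<phi> \<circ> inv_into V d) \<circ> ?T has_derivative
        frechet_derivative (\<phi> \<circ> inv_into V d) (at (d p)) \<circ> frechet_derivative ?T (at (c p))) (at (c p))"
      using diff_chain_at[OF T] Tp by simp
    then have "(\<phi> \<circ> inv_into U c has_derivative
        frechet_derivative (\<phi> \<circ> inv_into V d) (at (d p)) \<circ> frechet_derivative ?T (at (c p))) (at (c p))"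
    proof (rule has_derivative_transform_within_open)
      show "open (c ` (U \<inter> V))" using assms chart_facts by blast
      show "c p \<in> c ` (U \<inter> V)" using assms by blast
      show "((\<phi> \<circ> inv_into V d) \<circ> ?T) x = (\<phi> \<circ> inv_into U c) x" if "x \<in> c ` (U \<inter> V)" for x
        using that assms chart_facts(2) by auto
    qed
    then show ?thesis using True by (simp add: chart_derivative_def flip: frechet_derivative_at)
  qed (simp add: chart_derivative_def)
qed

lemma tangent_space_eq_range:
  assumes "(U, c) \<in> A" "p \<in> U"
  shows "tangent_space A p = range (chart_derivative A (U, c) p)"
proof
  show "tangent_space A p \<subseteq> range (chart_derivative A (U, c) p)"
  proof
    fix u assume "u \<in> tangent_space A p"
    then obtain V d w where "(V, d) \<in> A" "p \<in> V" "u = chart_derivative A (V, d) p w"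
      by (auto simp: tangent_space_def)
    then show "u \<in> range (chart_derivative A (U, c) p)"
      using chart_derivative_change[OF _ _ assms] by blast
  qed
  show "range (chart_derivative A (U, c) p) \<subseteq> tangent_space A p"
    using assms by (auto simp: tangent_space_def)
qed

lemma subspace_tangent_space: "subspace (tangent_space A p)"
proof -
  obtain U c where "(U, c) \<in> A" "p \<in> U" by (rule chart_exists)
  then show ?thesis
    using tangent_space_eq_range linear_subspace_image[OF linear_chart_derivative subspace_UNIV] by metis
qed

text \<open>The coordinate functions of the chart are smooth near \<open>p\<close>, and their derivatives along a
  tangent vector are its components.\<close>

lemma inj_chart_derivative:
  assumes "(U, c) \<in> A" "p \<in> U"
  shows "inj (chart_derivative A (U, c) p)"
proof -
  interpret linear "chart_derivative A (U, c) p" by (rule linear_chart_derivative[OF assms])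
  have "w = 0" if "chart_derivative A (U, c) p w = 0" for w
  proof (rule euclidean_eqI)
    fix b :: 'b
    have "smooth_fun_on A U (\<lambda>q. c q \<bullet> b)"
      unfolding smooth_fun_on_def smooth_on_def
    proof (clarify)
      fix V d k assume V: "(V, d) \<in> A"
      then have "C_k_on k (d ` (V \<inter> U)) (c \<circ> inv_into V d)"
        using assms by (intro chart_transition_C_k)
      then have "C_k_on k (d ` (V \<inter> U)) (\<lambda>x. (c \<circ> inv_into V d) x \<bullet> b)"
        by (intro C_k_on_bounded_linear[where L = "\<lambda>x. x \<bullet> b"] chart_facts(3)[OF V]
            chart_facts(1)[OF assms(1)] bounded_linear_inner_left)
      then show "C_k_on k (d ` (V \<inter> U)) ((\<lambda>q. c q \<bullet> b) \<circ> inv_into V d)"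
        by (simp add: o_def)
    qed
    then have near: "smooth_near A p (\<lambda>q. c q \<bullet> b)"
      using assms chart_facts by (auto simp: smooth_near_def)
    have "((\<lambda>x. x \<bullet> b) has_derivative (\<lambda>x. x \<bullet> b)) (at (c p))"
      by (intro bounded_linear_imp_has_derivative bounded_linear_inner_left)
    then have "((\<lambda>q. c q \<bullet> b) \<circ> inv_into U c has_derivative (\<lambda>x. x \<bullet> b)) (at (c p))"
    proof (rule has_derivative_transform_within_open)
      show "open (c ` (U \<inter> UNIV))" using assms chart_facts by blast
      show "c p \<in> c ` (U \<inter> UNIV)" using assms by blast
    qed (auto simp: f_inv_into_f)
    then have "frechet_derivative ((\<lambda>q. c q \<bullet> b) \<circ> inv_into U c) (at (c p)) w = w \<bullet> b"
      by (simp flip: frechet_derivative_at)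
    moreover have "chart_derivative A (U, c) p w (\<lambda>q. c q \<bullet> b) = 0" using that by simp
    ultimately show "w \<bullet> b = 0 \<bullet> b" using near by (simp add: chart_derivative_def)
  qed
  then show ?thesis by (simp add: inj_iff_eq_0)
qed

lemma tangent_space_parametrization:
  obtains e :: "'b \<Rightarrow> 'a tangent" where "linear e" "inj e" "range e = tangent_space A p"
  by (metis chart_exists linear_chart_derivative inj_chart_derivative tangent_space_eq_range)

lemma vector_field_in_tangent_space: "X \<in> vector_fields A \<Longrightarrow> X p \<in> tangent_space A p"
  by (simp add: vector_fields_def)

lemma vector_fields_add:
  assumes "X \<in> vector_fields A" "Y \<in> vector_fields A"
  shows "X + Y \<in> vector_fields A"
  using assms subspace_tangent_space
  by (auto simp: vector_fields_def plus_fun_def[of "X"] intro: subspace_add smooth_fun_on_add)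

lemma vector_fields_scale_by:
  assumes "smooth_fun_on A UNIV u" "X \<in> vector_fields A"
  shows "u \<odot> X \<in> vector_fields A"
proof -
  have "(u \<odot> X) p \<in> tangent_space A p" for p
    using assms(2) subspace_scale[OF subspace_tangent_space]
    by (simp add: vector_fields_def scale_by_def)
  then show ?thesis
    using assms(2) smooth_fun_on_subset[OF assms(1)]
    by (auto simp: vector_fields_def scale_by_def scaleR_fun_def intro: smooth_fun_on_mult)
qed

end

section \<open>Alternating forms in odd dimension\<close>

text \<open>If \<open>\<omega> x y \<noteq> 0\<close>, then \<open>S\<close> is the direct sum of the plane spanned by \<open>x\<close> and \<open>y\<close> and of its
  \<open>\<omega>\<close>-complement. Passing to the complement lowers the dimension by two, so in odd dimension the
  induction ends with a degenerate vector, which is \<open>\<omega>\<close>-orthogonal to the removed planes as well.\<close>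

lemma alternating_form_degenerate_on_odd_dim:
  fixes \<omega> :: "'b::euclidean_space \<Rightarrow> 'b \<Rightarrow> real"
  assumes "bilinear \<omega>" "\<And>x. \<omega> x x = 0" "subspace S" "odd (dim S)"
  obtains x where "x \<in> S" "x \<noteq> 0" "\<And>y. y \<in> S \<Longrightarrow> \<omega> x y = 0"
proof -
  note lin = bilinear_ladd[OF assms(1)] bilinear_radd[OF assms(1)]
    bilinear_lmul[OF assms(1)] bilinear_rmul[OF assms(1)]
    bilinear_lsub[OF assms(1)] bilinear_rsub[OF assms(1)]
  have skew: "\<omega> x y = - \<omega> y x" for x y
    using assms(2)[of "x + y"] assms(2)[of x] assms(2)[of y] by (simp add: lin)
  have "\<exists>x\<in>S. x \<noteq> 0 \<and> (\<forall>y\<in>S. \<omega> x y = 0)" using assms(3,4)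
  proof (induction "dim S" arbitrary: S rule: less_induct)
    case less
    have "S \<noteq> {0}" using less.prems by auto
    then obtain x where x: "x \<in> S" "x \<noteq> 0" using less.prems subspace_0 by blast
    show ?case
    proof (cases "\<forall>y\<in>S. \<omega> x y = 0")
      case False
      then obtain y where y: "y \<in> S" "\<omega> x y \<noteq> 0" by blast
      define S' where "S' = {s \<in> S. \<omega> x s = 0 \<and> \<omega> y s = 0}"
      have sub: "subspace S'"
        using less.prems by (auto simp: S'_def subspace_def lin bilinear_rzero[OF assms(1)])
      have decomp: "\<exists>a b. s - a *\<^sub>R x - b *\<^sub>R y \<in> S'" if "s \<in> S" for s
      proof (intro exI)
        show "s - (\<omega> y s / \<omega> y x) *\<^sub>R x - (\<omega> x s / \<omega> x y) *\<^sub>R y \<in> S'"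
          using x y that less.prems(1) skew[of y x] assms(2)
          by (simp add: S'_def lin subspace_diff subspace_add subspace_scale)
      qed
      have "y \<notin> span S'" using y sub by (auto simp: S'_def span_eq_iff[THEN iffD2])
      moreover have "x \<notin> span (insert y S')"
      proof
        assume "x \<in> span (insert y S')"
        then obtain k where "x - k *\<^sub>R y \<in> S'"
          using sub by (auto simp: span_insert span_eq_iff[THEN iffD2])
        then have "\<omega> y x = 0" using assms(2) by (simp add: S'_def lin)
        then show False using y skew[of y x] by simp
      qed
      moreover have "span (insert x (insert y S')) = S"
      proof
        show "span (insert x (insert y S')) \<subseteq> S"
          using x y less.prems by (intro span_minimal) (auto simp: S'_def)
        show "S \<subseteq> span (insert x (insert y S'))"
        proof
          fix s assume "s \<in> S"
          then obtain a b where "s - a *\<^sub>R x - b *\<^sub>R y \<in> S'" using decomp by blast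
          then have "s - a *\<^sub>R x - b *\<^sub>R y \<in> span S'" by (rule span_base)
          then show "s \<in> span (insert x (insert y S'))" by (auto simp: span_insert)
        qed
      qed
      ultimately have "dim S = dim S' + 2" by (metis add_2_eq_Suc' dim_insert dim_span Suc_eq_plus1)
      then obtain z where z: "z \<in> S'" "z \<noteq> 0" "\<forall>s\<in>S'. \<omega> z s = 0"
        using less.hyps[of S'] less.prems sub by auto
      have "\<omega> z s = 0" if "s \<in> S" for s
      proof -
        obtain a b where "s - a *\<^sub>R x - b *\<^sub>R y \<in> S'"
          using decomp[OF \<open>s \<in> S\<close>] by blast
        then have "\<omega> z (s - a *\<^sub>R x - b *\<^sub>R y) = 0" using z by blast
        moreover have "\<omega> z x = 0" "\<omega> z y = 0"
          using z(1) skew[of z x] skew[of z y] by (auto simp: S'_def)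
        ultimately show ?thesis by (simp add: lin)
      qed
      then show ?thesis using z by (auto simp: S'_def)
    qed (use x in blast)
  qed
  then show thesis using that by blast
qed

section \<open>Pointwise algebra of the structure tensors\<close>

lemma linear_on_subspace_rules:
  assumes "linear_on_subspace S L" "subspace S"
  shows "u \<in> S \<Longrightarrow> v \<in> S \<Longrightarrow> L (u + v) = L u + L v"
    and "u \<in> S \<Longrightarrow> L (c *\<^sub>R u) = c *\<^sub>R L u"
    and "L 0 = 0"
    and "u \<in> S \<Longrightarrow> L (- u) = - L u"
    and "u \<in> S \<Longrightarrow> v \<in> S \<Longrightarrow> L (u - v) = L u - L v"
proof -
  show add: "L (u + v) = L u + L v" if "u \<in> S" "v \<in> S" for u v
    using assms that by (simp add: linear_on_subspace_def)
  show scale: "L (c *\<^sub>R u) = c *\<^sub>R L u" if "u \<in> S" for c u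
    using assms that by (simp add: linear_on_subspace_def)
  show "L 0 = 0" using scale[of 0 0] subspace_0[OF assms(2)] by simp
  show minus: "L (- u) = - L u" if "u \<in> S" for u
    using scale[OF that, of "-1"] by simp
  show "L (u - v) = L u - L v" if "u \<in> S" "v \<in> S" for u v
    using add[OF that(1) subspace_neg[OF assms(2) that(2)]] minus[OF that(2)] by simp
qed

locale weak_quasi_contact =
  fixes A :: "('a::{t2_space, second_countable_topology}, 'b::euclidean_space) chart set"
    and nabla :: "'a vfield \<Rightarrow> 'a vfield \<Rightarrow> 'a vfield"
    and f Q :: "'a tensor11" and \<xi> :: "'a vfield" and \<eta> :: "'a form1" and g :: "'a tensor02"
  assumes atlas: "smooth_atlas A"
    and odd_dim: "odd DIM('b)"
    and wqc: "weak_quasi_contact_metric A nabla f Q \<xi> \<eta> g"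
begin

abbreviation T :: "'a \<Rightarrow> 'a tangent set" where "T \<equiv> tangent_space A"
abbreviation fields :: "'a vfield set" where "fields \<equiv> vector_fields A"
abbreviation h :: "'a vfield \<Rightarrow> 'a vfield" where "h \<equiv> tensor_h A f \<xi>"
abbreviation D :: "'a vfield \<Rightarrow> 'a vfield \<Rightarrow> 'a vfield"
  where "D X Y \<equiv> cov_deriv nabla X (act f) Y"

lemma almost_contact: "weak_almost_contact_metric A f Q \<xi> \<eta> g" and levi_civita_nabla: "levi_civita A g nabla"
  using wqc by (auto simp: weak_quasi_contact_metric_def)

lemma tensor_f: "is_tensor11 A f" and tensor_Q: "is_tensor11 A Q" and nonsing: "nonsingular A Q"
  and xi_field [simp]: "\<xi> \<in> fields" and form_eta: "is_form1 A \<eta>" and metric: "riemannian_metric A g"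
  and eta_xi [simp]: "\<eta> p (\<xi> p) = 1"
  using almost_contact by (auto simp: weak_almost_contact_metric_def)

lemmas T_subspace = subspace_tangent_space[OF atlas]

lemma T_closed [simp]:
  "0 \<in> T p"
  "u \<in> T p \<Longrightarrow> v \<in> T p \<Longrightarrow> u + v \<in> T p"
  "u \<in> T p \<Longrightarrow> v \<in> T p \<Longrightarrow> u - v \<in> T p"
  "u \<in> T p \<Longrightarrow> - u \<in> T p"
  "u \<in> T p \<Longrightarrow> c *\<^sub>R u \<in> T p"
  "u \<in> T p \<Longrightarrow> f p u \<in> T p"
  "u \<in> T p \<Longrightarrow> Q p u \<in> T p"
  "X \<in> fields \<Longrightarrow> X p \<in> T p"
  using T_subspace[of p] tensor_f tensor_Q
  by (auto simp: subspace_0 subspace_add subspace_diff subspace_neg subspace_scale is_tensor11_def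
      image_subset_iff vector_field_in_tangent_space[OF atlas])

lemma linear_f: "linear_on_subspace (T p) (f p)" and linear_Q: "linear_on_subspace (T p) (Q p)"
  and linear_eta: "linear_on_subspace (T p) (\<eta> p)"
  using tensor_f tensor_Q form_eta by (auto simp: is_tensor11_def is_form1_def)

lemma linear_g_right: "u \<in> T p \<Longrightarrow> linear_on_subspace (T p) (g p u)"
  and g_sym: "u \<in> T p \<Longrightarrow> v \<in> T p \<Longrightarrow> g p u v = g p v u"
  and g_pos: "u \<in> T p \<Longrightarrow> u \<noteq> 0 \<Longrightarrow> g p u u > 0"
  using metric by (auto simp: riemannian_metric_def)

lemma linear_g_left: "v \<in> T p \<Longrightarrow> linear_on_subspace (T p) (\<lambda>u. g p u v)"
  using linear_g_right[of v p] g_sym[of _ p v]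
  by (simp add: linear_on_subspace_def subspace_add[OF T_subspace] subspace_scale[OF T_subspace])

lemmas f_lin = linear_on_subspace_rules[OF linear_f T_subspace]
lemmas Q_lin = linear_on_subspace_rules[OF linear_Q T_subspace]
lemmas eta_lin = linear_on_subspace_rules[OF linear_eta T_subspace]
lemmas g_lin = linear_on_subspace_rules[OF linear_g_left T_subspace]
  linear_on_subspace_rules[OF linear_g_right T_subspace]

lemma g_eq_0_iff: "u \<in> T p \<Longrightarrow> g p u u = 0 \<longleftrightarrow> u = 0"
  using g_pos[of u p] g_lin(3)[of 0 p] by force

lemma f_squared: "u \<in> T p \<Longrightarrow> f p (f p u) = - Q p u + \<eta> p u *\<^sub>R \<xi> p"
  and eta_g: "u \<in> T p \<Longrightarrow> \<eta> p u = g p (\<xi> p) u"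
  and g_ff_Q: "u \<in> T p \<Longrightarrow> v \<in> T p \<Longrightarrow> g p (f p u) (f p v) = g p u (Q p v) - \<eta> p u * \<eta> p v"
  using almost_contact by (auto simp: weak_almost_contact_metric_def)

lemma Q_bij: "bij_betw (Q p) (T p) (T p)"
  using nonsing by (simp add: nonsingular_def)

lemma Q_eq_0: "u \<in> T p \<Longrightarrow> Q p u = 0 \<Longrightarrow> u = 0"
  using Q_bij[of p] Q_lin(3)[of p] inj_on_eq_iff[of "Q p" "T p" u 0] by (auto simp: bij_betw_def)

text \<open>Eliminating \<open>Q\<close> from the two axioms for \<open>f\<close> yields skew-symmetry of \<open>f\<close> when one of the vectors
  lies in its image.\<close>

lemma g_f_f:
  assumes "u \<in> T p" "v \<in> T p"
  shows "g p (f p u) (f p v) = - g p u (f p (f p v))"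
proof -
  have "g p u (\<xi> p) = \<eta> p u" using assms by (simp add: eta_g g_sym)
  then show ?thesis using assms by (simp add: f_squared g_ff_Q g_lin)
qed

text \<open>Let \<open>b\<close> be the symmetric form that measures the failure of skew-symmetry. It vanishes when one
  argument lies in the image of \<open>f\<close>, so \<open>b u (Q w) = \<eta>(w) b u \<xi>\<close>, and since \<open>Q\<close> is onto, only
  \<open>b \<xi> \<xi>\<close> remains. If it were nonzero, then the solution \<open>a\<close> of \<open>Q a = \<xi>\<close> would lie in the kernel of
  \<open>f\<close>, which gives \<open>b a a = 0\<close>, while writing \<open>a = Q e\<close> gives \<open>b a a = \<eta>(e)\<^sup>2 b \<xi> \<xi>\<close> with
  \<open>\<eta>(e) = |a|\<^sup>2 \<noteq> 0\<close>.\<close>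

lemma f_skew:
  assumes "u \<in> T p" "v \<in> T p"
  shows "g p (f p u) v = - g p u (f p v)"
proof -
  define b where "b u v = g p (f p u) v + g p u (f p v)" for u v
  have b_sym: "b u v = b v u" if "u \<in> T p" "v \<in> T p" for u v
    using that by (simp add: b_def g_sym)
  have b_f: "b u (f p v) = 0" if "u \<in> T p" "v \<in> T p" for u v
    using that g_f_f[of u p v] by (simp add: b_def)
  have b_Q: "b u (Q p w) = \<eta> p w * b u (\<xi> p)" if "u \<in> T p" "w \<in> T p" for u w
  proof -
    have Qw: "Q p w = \<eta> p w *\<^sub>R \<xi> p - f p (f p w)" using that by (simp add: f_squared)
    have "b u (\<eta> p w *\<^sub>R \<xi> p - f p (f p w)) = \<eta> p w * b u (\<xi> p) - b u (f p (f p w))"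
      unfolding b_def using that by (simp add: g_lin f_lin algebra_simps)
    then show ?thesis unfolding Qw using that by (simp add: b_f)
  qed
  have surj: "\<exists>w\<in>T p. Q p w = u" if "u \<in> T p" for u
    using that by (metis bij_betw_imp_surj_on[OF Q_bij] imageE)
  obtain a where a: "a \<in> T p" "Q p a = \<xi> p" using surj[of "\<xi> p"] by auto
  obtain e where e: "e \<in> T p" "Q p e = a" using surj a by blast
  have b_xi: "b (\<xi> p) (\<xi> p) = 0"
  proof (rule ccontr)
    assume ne: "b (\<xi> p) (\<xi> p) \<noteq> 0"
    then have eta_a: "\<eta> p a = 1" using b_Q[of "\<xi> p" a] a by simp
    then have "f p (f p a) = 0" using a by (simp add: f_squared)
    then have "g p (f p a) (f p a) = 0" using a g_f_f[of a p a] by (simp add: g_lin)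
    then have fa: "f p a = 0" using a by (simp add: g_eq_0_iff)
    have "g p (f p (f p e)) a = 0"
      using g_f_f[of a p e] g_sym[of a p "f p (f p e)"] fa a e by (simp add: g_lin)
    then have "g p (\<eta> p e *\<^sub>R \<xi> p - f p (f p e)) a = \<eta> p e * \<eta> p a"
      using a e by (simp add: g_lin eta_g[of a p])
    moreover have "\<eta> p e *\<^sub>R \<xi> p - f p (f p e) = a" using e by (simp add: f_squared)
    ultimately have "g p a a = \<eta> p e * \<eta> p a" by simp
    then have "\<eta> p e \<noteq> 0" using eta_a a g_eq_0_iff[of a p] eta_lin(3)[of p] by auto
    moreover have "b a a = \<eta> p e * (\<eta> p e * b (\<xi> p) (\<xi> p))"
      using b_Q[of a e] b_sym[of a "\<xi> p"] b_Q[of "\<xi> p" e] a e by simp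
    moreover have "b a a = 0" using fa a by (simp add: b_def g_lin)
    ultimately show False using ne by simp
  qed
  obtain c d where cd: "c \<in> T p" "Q p c = u" "d \<in> T p" "Q p d = v" using surj assms by metis
  have "b u v = \<eta> p d * b u (\<xi> p)" using b_Q[of u d] cd assms by simp
  also have "b u (\<xi> p) = \<eta> p c * b (\<xi> p) (\<xi> p)"
    using b_sym[of u "\<xi> p"] b_Q[of "\<xi> p" c] cd assms by simp
  finally show ?thesis using b_xi by (simp add: b_def)
qed

lemma kernel_f:
  assumes "v \<in> T p" "f p v = 0"
  shows "Q p v = \<eta> p v *\<^sub>R \<xi> p" "v \<noteq> 0 \<Longrightarrow> \<eta> p v \<noteq> 0"
proof -
  show Qv: "Q p v = \<eta> p v *\<^sub>R \<xi> p" using f_squared[OF assms(1)] assms(2) by (simp add: f_lin)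
  show "\<eta> p v \<noteq> 0" if "v \<noteq> 0" using Qv that Q_eq_0[OF assms(1)] by auto
qed

text \<open>By skew-symmetry \<open>g (f u) v\<close> is an alternating form on a space of odd dimension.\<close>

lemma kernel_f_nontrivial: obtains v where "v \<in> T p" "v \<noteq> 0" "f p v = 0"
proof -
  obtain e :: "'b \<Rightarrow> 'a tangent" where e: "linear e" "inj e" "range e = T p"
    by (rule tangent_space_parametrization[OF atlas])
  interpret e: linear e by fact
  have eT [simp]: "e x \<in> T p" for x using e by blast
  define \<omega> where "\<omega> x y = g p (f p (e x)) (e y)" for x y
  have "bilinear \<omega>"
    by (auto simp: bilinear_def \<omega>_def e.add e.scale f_lin g_lin intro!: linearI)
  moreover have "\<omega> x x = 0" for x
    using f_skew[of "e x" p "e x"] g_sym[of "e x" p "f p (e x)"] by (simp add: \<omega>_def)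
  ultimately obtain x where x: "x \<noteq> 0" "\<And>y. \<omega> x y = 0"
    using alternating_form_degenerate_on_odd_dim[of \<omega> UNIV] odd_dim by auto
  have "f p (e x) \<in> range e" using e(3) by simp
  then have "\<omega> x (inv e (f p (e x))) = g p (f p (e x)) (f p (e x))"
    by (simp add: \<omega>_def f_inv_into_f)
  then have "f p (e x) = 0" using x(2) by (simp add: g_eq_0_iff)
  moreover have "e x \<noteq> 0" using x(1) e.zero inj_eq[OF e(2), of x 0] by auto
  ultimately show thesis using that eT by blast
qed

section \<open>Vector fields and the connection\<close>

lemma smooth_closed [simp]:
  "smooth_fun_on A UNIV (\<lambda>p. c)"
  "X \<in> fields \<Longrightarrow> Y \<in> fields \<Longrightarrow> smooth_fun_on A UNIV (metric_fun g X Y)"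
  "X \<in> fields \<Longrightarrow> smooth_fun_on A UNIV (\<eta> \<cdot> X)"
  using metric form_eta smooth_fun_on_const[OF atlas]
  by (auto simp: riemannian_metric_def is_form1_def)

lemma scaleR_eq_scale_by: "c *\<^sub>R X = (\<lambda>p. c) \<odot> (X :: 'a vfield)"
  by (simp add: scaleR_fun_def scale_by_def)

lemma fields_scale [simp]:
  "smooth_fun_on A UNIV u \<Longrightarrow> X \<in> fields \<Longrightarrow> u \<odot> X \<in> fields"
  "X \<in> fields \<Longrightarrow> c *\<^sub>R X \<in> fields"
  unfolding scaleR_eq_scale_by using vector_fields_scale_by[OF atlas] by auto

lemma fields_group [simp]:
  "0 \<in> fields"
  "X \<in> fields \<Longrightarrow> - X \<in> fields"
  "X \<in> fields \<Longrightarrow> Y \<in> fields \<Longrightarrow> X + Y \<in> fields"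
  "X \<in> fields \<Longrightarrow> Y \<in> fields \<Longrightarrow> X - Y \<in> fields"
proof -
  show "0 \<in> fields" using fields_scale(2)[of \<xi> 0] by simp
  show neg: "- X \<in> fields" if "X \<in> fields" for X using fields_scale(2)[OF that, of "-1"] by simp
  show add: "X + Y \<in> fields" if "X \<in> fields" "Y \<in> fields" for X Y
    using vector_fields_add[OF atlas that] .
  show "X - Y \<in> fields" if "X \<in> fields" "Y \<in> fields" for X Y
    using add[OF that(1) neg[OF that(2)]] by simp
qed

lemma fields_f_Q [simp]: "X \<in> fields \<Longrightarrow> f \<cdot> X \<in> fields" "X \<in> fields \<Longrightarrow> Q \<cdot> X \<in> fields"
  using tensor_f tensor_Q by (auto simp: is_tensor11_def)

lemma fields_nabla [simp]: "X \<in> fields \<Longrightarrow> Y \<in> fields \<Longrightarrow> nabla X Y \<in> fields"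
  using levi_civita_nabla by (simp add: levi_civita_def affine_connection_def)

lemma lie_bracket_eq: "X \<in> fields \<Longrightarrow> Y \<in> fields \<Longrightarrow> lie_bracket A X Y = nabla X Y - nabla Y X"
  using levi_civita_nabla by (simp add: levi_civita_def)

lemma nabla_add:
  assumes "X \<in> fields" "Y \<in> fields" "Z \<in> fields"
  shows "nabla (X + Y) Z = nabla X Z + nabla Y Z" "nabla X (Y + Z) = nabla X Y + nabla X Z"
  using levi_civita_nabla assms by (simp_all add: levi_civita_def affine_connection_def)

lemma nabla_scale_by:
  assumes "X \<in> fields" "Y \<in> fields" "smooth_fun_on A UNIV u"
  shows "nabla (u \<odot> X) Y = u \<odot> nabla X Y"
    "nabla X (u \<odot> Y) = u \<odot> nabla X Y + (\<lambda>p. X p u) \<odot> Y"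
  using levi_civita_nabla assms by (simp_all add: levi_civita_def affine_connection_def)

text \<open>Compare the Leibniz rule for \<open>1 \<odot> \<xi>\<close> with \<open>1 \<odot> \<xi> = \<xi>\<close>.\<close>

lemma field_one:
  assumes "X \<in> fields"
  shows "X p (\<lambda>q. 1) = 0"
proof -
  have "(\<lambda>p. 1) \<odot> Y = Y" for Y :: "'a vfield" by (simp add: scale_by_def)
  then have "(\<lambda>p. X p (\<lambda>q. 1)) \<odot> \<xi> = 0"
    using nabla_scale_by(2)[OF assms xi_field smooth_closed(1)[of 1]] by simp
  then have "((\<lambda>p. X p (\<lambda>q. 1)) \<odot> \<xi>) p = 0" by (rule fun_cong[where g = "\<lambda>_. 0", folded zero_fun_def])
  moreover have "\<xi> p \<noteq> 0" using eta_xi[of p] eta_lin(3)[of p] by (metis zero_neq_one)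
  ultimately show ?thesis by (simp add: scale_by_def)
qed

end

section \<open>The Reeb field lies in the kernel of f\<close>

text \<open>For pairwise orthogonal \<open>Ys\<close> this is \<open>X\<close> minus its orthogonal projection to their span,
  multiplied by the product of all \<open>|Y|\<^sup>2\<close>. The factor clears the denominators, so the result is a
  smooth field even where some \<open>Y\<close> vanishes; there the result vanishes too.\<close>

primrec orthogonal_residue :: "'a tensor02 \<Rightarrow> 'a vfield list \<Rightarrow> 'a vfield \<Rightarrow> 'a vfield"
  where
    "orthogonal_residue g [] X = X"
  | "orthogonal_residue g (Y # Ys) X =
      (let R = orthogonal_residue g Ys X in metric_fun g Y Y \<odot> R - metric_fun g R Y \<odot> Y)"

text \<open>Gram-Schmidt for the sequence \<open>X, N X, N\<^sup>2 X, \<dots>\<close>, newest field first.\<close>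

primrec krylov_frame :: "'a tensor02 \<Rightarrow> ('a vfield \<Rightarrow> 'a vfield) \<Rightarrow> 'a vfield \<Rightarrow> nat \<Rightarrow> 'a vfield list"
  where
    "krylov_frame g N X 0 = [X]"
  | "krylov_frame g N X (Suc k) =
      (let Ys = krylov_frame g N X k in orthogonal_residue g Ys (N (hd Ys)) # Ys)"

declare orthogonal_residue.simps(2) [simp del] krylov_frame.simps(2) [simp del]

context weak_quasi_contact
begin

lemma contact_condition:
  assumes "X \<in> fields" "Y \<in> fields"
  shows "D X Y + D (f \<cdot> X) (f \<cdot> Y) =
    (2 *\<^sub>R metric_fun g X Y) \<odot> \<xi> - (\<eta> \<cdot> Y) \<odot> (X + h X + (\<eta> \<cdot> X) \<odot> \<xi>)"
  using wqc assms by (simp add: weak_quasi_contact_metric_def)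

lemma nabla_zero:
  assumes "X \<in> fields"
  shows "nabla 0 X = 0" "nabla X 0 = 0"
  using nabla_add(1)[of 0 0 X] nabla_add(2)[of X 0 0] assms by simp_all

lemma nabla_minus:
  assumes "X \<in> fields" "Y \<in> fields"
  shows "nabla (- X) Y = - nabla X Y" "nabla X (- Y) = - nabla X Y"
  using nabla_add(1)[of X "- X" Y] nabla_add(2)[of X Y "- Y"] nabla_zero assms
  by (simp_all add: eq_neg_iff_add_eq_0 add.commute)

lemma nabla_diff:
  assumes "X \<in> fields" "Y \<in> fields" "Z \<in> fields"
  shows "nabla (X - Y) Z = nabla X Z - nabla Y Z" "nabla X (Y - Z) = nabla X Y - nabla X Z"
  using nabla_add(1)[of X "- Y" Z] nabla_add(2)[of X Y "- Z"] nabla_minus assms by simp_all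

lemma metric_compatible:
  assumes "X \<in> fields" "Y \<in> fields" "Z \<in> fields"
  shows "X p (metric_fun g Y Z) = g p (nabla X Y p) (Z p) + g p (Y p) (nabla X Z p)"
  using levi_civita_nabla assms by (simp add: levi_civita_def metric_fun_def)

lemma f_field_lin:
  assumes "X \<in> fields" "Y \<in> fields"
  shows "f \<cdot> (X + Y) = f \<cdot> X + f \<cdot> Y" "f \<cdot> (X - Y) = f \<cdot> X - f \<cdot> Y" "f \<cdot> (- X) = - (f \<cdot> X)"
    "f \<cdot> 0 = 0" "f \<cdot> (u \<odot> X) = u \<odot> (f \<cdot> X)" "f \<cdot> (c *\<^sub>R X) = c *\<^sub>R (f \<cdot> X)"
proof -
  have apply_simps: "(U + V) p = U p + V p" "(U - V) p = U p - V p" "(- U) p = - U p"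
    "(0 :: 'a vfield) p = 0" "(c *\<^sub>R U) p = c *\<^sub>R U p" for U V :: "'a vfield" and p c
    by (simp_all add: scaleR_fun_def)
  show "f \<cdot> (X + Y) = f \<cdot> X + f \<cdot> Y" "f \<cdot> (X - Y) = f \<cdot> X - f \<cdot> Y" "f \<cdot> (- X) = - (f \<cdot> X)"
    "f \<cdot> 0 = 0" "f \<cdot> (u \<odot> X) = u \<odot> (f \<cdot> X)" "f \<cdot> (c *\<^sub>R X) = c *\<^sub>R (f \<cdot> X)"
    by (rule ext, simp only: apply_simps act_def scale_by_def, simp only: f_lin T_closed assms)+
qed

lemma D_field [simp]: "X \<in> fields \<Longrightarrow> Y \<in> fields \<Longrightarrow> D X Y \<in> fields"
  by (simp add: cov_deriv_def)

text \<open>Differentiate \<open>g (f Y) Z = - g Y (f Z)\<close> along \<open>X\<close>.\<close>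

lemma D_skew:
  assumes "X \<in> fields" "Y \<in> fields" "Z \<in> fields"
  shows "g p (D X Y p) (Z p) = - g p (Y p) (D X Z p)"
proof -
  have "metric_fun g (f \<cdot> Y) Z = metric_fun g Y (- (f \<cdot> Z))"
    using assms by (simp add: fun_eq_iff metric_fun_def act_def f_skew g_lin)
  then have "X p (metric_fun g (f \<cdot> Y) Z) = X p (metric_fun g Y (- (f \<cdot> Z)))" by simp
  then have "g p (nabla X (f \<cdot> Y) p) (Z p) + g p (f p (Y p)) (nabla X Z p) =
      - g p (nabla X Y p) (f p (Z p)) - g p (Y p) (nabla X (f \<cdot> Z) p)"
    using assms by (simp add: metric_compatible nabla_minus g_lin) (simp add: act_def g_lin assms)
  then show ?thesis
    using assms f_skew[of "nabla X Y p" p "Z p"] f_skew[of "Y p" p "nabla X Z p"]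
    by (simp add: cov_deriv_def act_def[of f "nabla X Y"] act_def[of f "nabla X Z"] g_lin)
qed

lemma h_eq:
  assumes "X \<in> fields"
  shows "2 *\<^sub>R h X = lie_bracket A \<xi> (f \<cdot> X) - f \<cdot> lie_bracket A \<xi> X"
  by (simp add: tensor_h_def lie_deriv_def)

lemma h_field [simp]: "X \<in> fields \<Longrightarrow> h X \<in> fields"
  by (simp add: tensor_h_def lie_deriv_def lie_bracket_eq)

text \<open>Put \<open>X = Y = V\<close> in the contact condition and pair with \<open>V\<close>. The left side vanishes because
  \<open>\<nabla>\<^sub>V f\<close> is skew-symmetric and \<open>f V = 0\<close>; also \<open>g (h V) V = 0\<close>, since \<open>2 h V = - f [\<xi>, V]\<close> lies in the
  image of \<open>f\<close>. What is left is \<open>|V|\<^sup>2 = \<eta>(V)\<^sup>2\<close>, the case of equality in the Cauchy-Schwarz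
  inequality for \<open>V\<close> and the unit vector \<open>\<xi>\<close>.\<close>

lemma annihilated_field_parallel:
  assumes "V \<in> fields" "f \<cdot> V = 0"
  shows "V p = \<eta> p (V p) *\<^sub>R \<xi> p"
proof (cases "V p = 0")
  case True
  then show ?thesis by (simp add: eta_lin)
next
  case False
  let ?v = "V p" let ?c = "\<eta> p (V p)"
  have fv: "f p ?v = 0" using fun_cong[OF assms(2), of p] by (simp add: act_def)
  have c: "?c \<noteq> 0" using kernel_f(2)[of ?v p] assms fv False by simp
  have gv: "g p ?v (\<xi> p) = ?c" "g p (\<xi> p) ?v = ?c" using assms by (simp_all add: eta_g g_sym)
  have hV: "2 *\<^sub>R h V = - (f \<cdot> lie_bracket A \<xi> V)"
    using assms by (simp add: h_eq lie_bracket_eq nabla_zero)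
  have "2 * g p (h V p) ?v = g p ((2 *\<^sub>R h V) p) ?v"
    using assms by (simp add: scaleR_fun_def[of 2 "h V"] g_lin)
  also have "\<dots> = 0"
    unfolding hV using assms fv f_skew[of "lie_bracket A \<xi> V p" p ?v]
    by (simp add: act_def g_lin lie_bracket_eq)
  finally have hv: "g p (h V p) ?v = 0" by simp
  have "D V V = (2 *\<^sub>R metric_fun g V V) \<odot> \<xi> - (\<eta> \<cdot> V) \<odot> (V + h V + (\<eta> \<cdot> V) \<odot> \<xi>)"
    using contact_condition[OF assms(1,1)] assms by (simp add: cov_deriv_def nabla_zero f_field_lin)
  then have "D V V p = (2 * g p ?v ?v) *\<^sub>R \<xi> p - ?c *\<^sub>R (?v + h V p + ?c *\<^sub>R \<xi> p)"
    by (simp add: scale_by_def metric_fun_def act_def scaleR_fun_def[of 2 "\<lambda>p. g p (V p) (V p)"])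
  then have "g p (D V V p) ?v = 2 * g p ?v ?v * ?c - ?c * (g p ?v ?v + ?c * ?c)"
    using assms hv by (simp add: g_lin gv)
  moreover have "g p (D V V p) ?v = 0"
    using D_skew[of V V V p] assms g_sym[of "D V V p" p ?v] by simp
  ultimately have "?c * (g p ?v ?v - ?c * ?c) = 0" by algebra
  then have "g p ?v ?v = ?c * ?c" using c by simp
  then have "g p (?v - ?c *\<^sub>R \<xi> p) (?v - ?c *\<^sub>R \<xi> p) = 0"
    using assms eta_g[of "\<xi> p" p] by (simp add: g_lin gv)
  then show ?thesis using assms by (simp add: g_eq_0_iff)
qed

lemma residue_Cons:
  "orthogonal_residue g (Y # Ys) X p = g p (Y p) (Y p) *\<^sub>R orthogonal_residue g Ys X p
    - g p (orthogonal_residue g Ys X p) (Y p) *\<^sub>R Y p"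
  by (simp add: orthogonal_residue.simps(2) Let_def scale_by_def metric_fun_def)

lemma residue_field:
  "set Ys \<subseteq> fields \<Longrightarrow> X \<in> fields \<Longrightarrow> orthogonal_residue g Ys X \<in> fields"
  by (induction Ys) (simp_all add: Let_def orthogonal_residue.simps(2))

lemma residue_orthogonal:
  assumes "set Ys \<subseteq> fields" "X \<in> fields" "sorted_wrt (\<lambda>Y Z. g p (Y p) (Z p) = 0) Ys"
    "Y \<in> set Ys"
  shows "g p (orthogonal_residue g Ys X p) (Y p) = 0"
  using assms
proof (induction Ys)
  case (Cons Z Ys)
  let ?R = "orthogonal_residue g Ys X"
  have fields: "Z \<in> fields" "set Ys \<subseteq> fields" "Y \<in> fields" using Cons.prems by auto
  then have R: "?R \<in> fields" using Cons.prems(2) by (simp add: residue_field)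
  show ?case
  proof (cases "Y \<in> set Ys")
    case True
    then have "g p (?R p) (Y p) = 0" "g p (Z p) (Y p) = 0"
      using Cons.IH Cons.prems(2,3) fields by simp_all
    with R fields show ?thesis unfolding residue_Cons by (simp only: g_lin T_closed) simp
  next
    case False
    then have "Y = Z" using Cons.prems(4) by simp
    with R fields show ?thesis unfolding residue_Cons by (simp only: g_lin T_closed) simp
  qed
qed simp

text \<open>The constant \<open>c\<close> is the product of the squared lengths of the \<open>Y p\<close>.\<close>

lemma residue_span:
  assumes "set Ys \<subseteq> fields" "X \<in> fields"
  obtains c where "(\<forall>Y\<in>set Ys. Y p \<noteq> 0) \<longrightarrow> c \<noteq> 0"
    "orthogonal_residue g Ys X p - c *\<^sub>R X p \<in> span ((\<lambda>Y. Y p) ` set Ys)"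
proof -
  have "\<exists>c. ((\<forall>Y\<in>set Ys. Y p \<noteq> 0) \<longrightarrow> c \<noteq> 0) \<and>
      orthogonal_residue g Ys X p - c *\<^sub>R X p \<in> span ((\<lambda>Y. Y p) ` set Ys)"
    using assms
  proof (induction Ys)
    case Nil
    show ?case by (auto intro!: exI[of _ 1] simp: span_zero)
  next
    case (Cons Y Ys)
    let ?R = "orthogonal_residue g Ys X" and ?S = "span ((\<lambda>Y. Y p) ` set (Y # Ys))"
    obtain c where c: "(\<forall>Y\<in>set Ys. Y p \<noteq> 0) \<longrightarrow> c \<noteq> 0"
      "?R p - c *\<^sub>R X p \<in> span ((\<lambda>Y. Y p) ` set Ys)"
      using Cons.IH Cons.prems unfolding list.set insert_subset by blast
    let ?a = "g p (Y p) (Y p)"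
    have "?R p - c *\<^sub>R X p \<in> ?S" using c(2) span_mono[of "(\<lambda>Y. Y p) ` set Ys"] by auto
    moreover have "Y p \<in> ?S" by (simp add: span_base)
    ultimately have "?a *\<^sub>R (?R p - c *\<^sub>R X p) - g p (?R p) (Y p) *\<^sub>R Y p \<in> ?S"
      by (rule span_diff[OF span_scale span_scale])
    moreover have "?a *\<^sub>R (?R p - c *\<^sub>R X p) - g p (?R p) (Y p) *\<^sub>R Y p =
        orthogonal_residue g (Y # Ys) X p - (?a * c) *\<^sub>R X p"
      by (simp add: residue_Cons scaleR_diff_right)
    ultimately have "orthogonal_residue g (Y # Ys) X p - (?a * c) *\<^sub>R X p \<in> ?S" by metis
    moreover have "(\<forall>Z\<in>set (Y # Ys). Z p \<noteq> 0) \<longrightarrow> ?a * c \<noteq> 0"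
      using c(1) Cons.prems g_eq_0_iff[of "Y p" p] by auto
    ultimately show ?case by blast
  qed
  then show thesis using that by blast
qed

lemma residue_eq_0:
  assumes "set Ys \<subseteq> fields" "X \<in> fields" "Y \<in> set Ys" "Y p = 0"
  shows "orthogonal_residue g Ys X p = 0"
  using assms
proof (induction Ys)
  case (Cons Z Ys)
  have "orthogonal_residue g Ys X p \<in> T p" using Cons.prems by (simp add: residue_field)
  moreover have "Z p = 0 \<or> orthogonal_residue g Ys X p = 0" using Cons by auto
  moreover have "Z p \<in> T p" using Cons.prems(1) by simp
  ultimately show ?case by (auto simp: residue_Cons g_lin)
qed simp

text \<open>The form \<open>g p\<close> is linear only on the tangent space, hence the hypothesis on \<open>S\<close>.\<close>

lemma g_span_eq_0:
  assumes "w \<in> T p" "S \<subseteq> T p" "\<And>u. u \<in> S \<Longrightarrow> g p w u = 0" "u \<in> span S"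
  shows "g p w u = 0"
proof -
  have "span S \<subseteq> {u \<in> T p. g p w u = 0}"
    using assms by (intro span_minimal) (auto simp: subspace_def g_lin)
  then show ?thesis using assms(4) by auto
qed

text \<open>The start \<open>f\<^sup>2 \<xi>\<close>, instead of \<open>\<xi>\<close>, keeps the span inside the image of \<open>f\<close>.\<close>

definition krylov :: "nat \<Rightarrow> 'a vfield list"
  where "krylov = krylov_frame g (\<lambda>X. f \<cdot> f \<cdot> X) (f \<cdot> f \<cdot> \<xi>)"

definition krylov_values :: "nat \<Rightarrow> 'a \<Rightarrow> 'a tangent set"
  where "krylov_values k p = (\<lambda>Y. Y p) ` set (krylov k)"

lemma krylov_0: "krylov 0 = [f \<cdot> f \<cdot> \<xi>]"
  and krylov_Suc: "krylov (Suc k) = orthogonal_residue g (krylov k) (f \<cdot> f \<cdot> hd (krylov k)) # krylov k"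
  by (simp_all add: krylov_def krylov_frame.simps(2) Let_def)

lemma krylov_length: "length (krylov k) = Suc k"
  by (induction k) (simp_all add: krylov_0 krylov_Suc)

lemma krylov_hd: "hd (krylov k) \<in> set (krylov k)"
  by (metis krylov_length hd_in_set length_0_conv nat.distinct(1))

lemma krylov_fields: "set (krylov k) \<subseteq> fields"
proof (induction k)
  case (Suc k)
  have "hd (krylov k) \<in> fields" using Suc.IH krylov_hd by blast
  then show ?case using Suc.IH by (simp add: krylov_Suc residue_field)
qed (simp add: krylov_0)

lemma krylov_hd_field [simp]: "hd (krylov k) \<in> fields"
  using krylov_fields krylov_hd by blast

lemma krylov_start: "f \<cdot> f \<cdot> \<xi> \<in> set (krylov k)"
  by (induction k) (simp_all add: krylov_0 krylov_Suc)

lemma krylov_values_T: "krylov_values k p \<subseteq> T p"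
  using krylov_fields[of k] by (auto simp: krylov_values_def)

lemma krylov_orthogonal: "sorted_wrt (\<lambda>Y Z. g p (Y p) (Z p) = 0) (krylov k)"
proof (induction k)
  case (Suc k)
  then show ?case by (simp add: krylov_Suc residue_orthogonal krylov_fields)
qed (simp add: krylov_0)

lemma orthogonal_list_independent:
  assumes "set Ys \<subseteq> fields" "sorted_wrt (\<lambda>Y Z. g p (Y p) (Z p) = 0) Ys" "\<forall>Y\<in>set Ys. Y p \<noteq> 0"
  shows "independent ((\<lambda>Y. Y p) ` set Ys)" "card ((\<lambda>Y. Y p) ` set Ys) = length Ys"
proof -
  have "independent ((\<lambda>Y. Y p) ` set Ys) \<and> card ((\<lambda>Y. Y p) ` set Ys) = length Ys"
    using assms
  proof (induction Ys)
    case (Cons Y Ys)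
    have "Y p \<notin> span ((\<lambda>Y. Y p) ` set Ys)"
    proof
      assume in_span: "Y p \<in> span ((\<lambda>Y. Y p) ` set Ys)"
      have "Y p \<in> T p" "(\<lambda>Y. Y p) ` set Ys \<subseteq> T p"
        "\<And>u. u \<in> (\<lambda>Y. Y p) ` set Ys \<Longrightarrow> g p (Y p) u = 0"
        using Cons.prems by auto
      then have "g p (Y p) (Y p) = 0" using in_span by (rule g_span_eq_0)
      moreover have "Y p \<noteq> 0" using Cons.prems(3) unfolding list.set by blast
      moreover have "Y p \<in> T p" using Cons.prems(1) by simp
      ultimately show False using g_eq_0_iff[of "Y p" p] by simp
    qed
    moreover from this have "Y p \<notin> (\<lambda>Y. Y p) ` set Ys" using span_superset by (metis subsetD)
    moreover have "independent ((\<lambda>Y. Y p) ` set Ys)" "card ((\<lambda>Y. Y p) ` set Ys) = length Ys"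
      using Cons.IH Cons.prems by simp_all
    ultimately show ?case by (simp add: independent_insertI)
  qed (simp add: independent_empty)
  then show "independent ((\<lambda>Y. Y p) ` set Ys)" "card ((\<lambda>Y. Y p) ` set Ys) = length Ys" by auto
qed

lemma krylov_nonvanishing_bound:
  assumes "\<forall>Y\<in>set (krylov k). Y p \<noteq> 0"
  shows "Suc k \<le> DIM('b)"
proof -
  obtain e :: "'b \<Rightarrow> 'a tangent" where e: "linear e" "range e = T p"
    by (rule tangent_space_parametrization[OF atlas])
  have "T p = span (e ` Basis)" using linear_span_image[OF e(1), of Basis] e(2) by simp
  then have "krylov_values k p \<subseteq> span (e ` Basis)" using krylov_values_T[of k p] by simp
  then have "card (krylov_values k p) \<le> card (e ` Basis)"
    using orthogonal_list_independent(1)[OF krylov_fields krylov_orthogonal assms]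
    by (intro independent_span_bound[THEN conjunct2]) (auto simp: krylov_values_def)
  also have "\<dots> \<le> DIM('b)" by (rule card_image_le) simp
  finally show ?thesis
    using orthogonal_list_independent(2)[OF krylov_fields krylov_orthogonal assms] krylov_length[of k]
    by (simp add: krylov_values_def)
qed

text \<open>As long as the frame does not vanish at \<open>p\<close>, the residue of \<open>N Y\<close> is a nonzero multiple of \<open>N Y\<close>
  up to the span of the earlier fields, where \<open>N = f\<^sup>2\<close> and \<open>Y\<close> is the newest field.\<close>

lemma krylov_image:
  assumes "\<forall>Y\<in>set (krylov k). Y p \<noteq> 0" "Y \<in> set (krylov k)"
  shows "f p (f p (Y p)) \<in> span (krylov_values (Suc k) p)"
  using assms
proof (induction k arbitrary: Y)
  have hd_case: "f p (f p (hd (krylov k) p)) \<in> span (krylov_values (Suc k) p)"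
    if nz: "\<forall>Y\<in>set (krylov k). Y p \<noteq> 0" for k
  proof -
    let ?N = "f \<cdot> f \<cdot> hd (krylov k)" and ?S = "span (krylov_values (Suc k) p)"
    have N: "?N \<in> fields" by simp
    obtain c where c: "c \<noteq> 0"
      "orthogonal_residue g (krylov k) ?N p - c *\<^sub>R ?N p \<in> span (krylov_values k p)"
      using residue_span[OF krylov_fields N, of k p] nz unfolding krylov_values_def by blast
    have "orthogonal_residue g (krylov k) ?N p - c *\<^sub>R ?N p \<in> ?S"
      using c(2) span_mono[of "krylov_values k p" "krylov_values (Suc k) p"] by (auto simp: krylov_values_def krylov_Suc)
    moreover have "orthogonal_residue g (krylov k) ?N p \<in> ?S"
      by (simp add: span_base krylov_values_def krylov_Suc)
    ultimately have "orthogonal_residue g (krylov k) ?N p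
        - (orthogonal_residue g (krylov k) ?N p - c *\<^sub>R ?N p) \<in> ?S"
      by (rule span_diff[rotated])
    then have "c *\<^sub>R ?N p \<in> ?S" by simp
    then have "inverse c *\<^sub>R (c *\<^sub>R ?N p) \<in> ?S" by (rule span_scale)
    then have "?N p \<in> ?S" unfolding scaleR_scaleR left_inverse[OF c(1)] scaleR_one .
    then show ?thesis by (simp add: act_def)
  qed
  {
    case 0
    then show ?case using hd_case[OF 0(1)] 0(2) by (simp add: krylov_0)
  next
    case (Suc k)
    show ?case
    proof (cases "Y \<in> set (krylov k)")
      case True
      then have "f p (f p (Y p)) \<in> span (krylov_values (Suc k) p)" using Suc by (simp add: krylov_Suc)
      then show ?thesis
        using span_mono[of "krylov_values (Suc k) p" "krylov_values (Suc (Suc k)) p"]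
        by (auto simp: krylov_values_def krylov_Suc)
    next
      case False
      then show ?thesis using hd_case[OF Suc.prems(1)] Suc.prems(2) by (simp add: krylov_Suc)
    qed
  }
qed

text \<open>All fields of the frame take values in the image of \<open>f\<close>, which is orthogonal to the kernel of
  the skew-symmetric \<open>f\<close>.\<close>

lemma krylov_orthogonal_kernel:
  assumes "v \<in> T p" "f p v = 0" "u \<in> span (krylov_values k p)"
  shows "g p v u = 0"
proof -
  have f_perp: "g p v (f p u) = 0" if "u \<in> T p" for u
    using f_skew[of v p u] assms that by (simp add: g_lin)
  have "g p v u = 0" if "u \<in> span (krylov_values k p)" for u using that
  proof (induction k arbitrary: u)
    case 0
    show ?case
      by (rule g_span_eq_0[OF assms(1) krylov_values_T _ 0])
        (simp add: krylov_values_def krylov_0 act_def f_perp)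
  next
    case (Suc k)
    let ?N = "f \<cdot> f \<cdot> hd (krylov k)"
    let ?R = "orthogonal_residue g (krylov k) ?N"
    have N: "?N \<in> fields" by simp
    obtain c where c: "?R p - c *\<^sub>R ?N p \<in> span (krylov_values k p)"
      using residue_span[OF krylov_fields N, of k p] unfolding krylov_values_def by blast
    have R: "?R p \<in> T p" "?N p \<in> T p" by (simp_all add: residue_field krylov_fields)
    have "g p v (?N p) = 0" using f_perp by (simp add: act_def)
    moreover have "g p v (?R p - c *\<^sub>R ?N p) = 0" by (rule Suc.IH[OF c])
    ultimately have "g p v (?R p) = 0" using R assms by (simp add: g_lin)
    moreover have "g p v w = 0" if "w \<in> krylov_values k p" for w using Suc.IH that span_base by blast
    ultimately show ?case
      by (intro g_span_eq_0[OF assms(1) krylov_values_T _ Suc.prems])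
        (auto simp: krylov_values_def krylov_Suc)
  qed
  then show ?thesis using assms(3) .
qed

text \<open>Suppose \<open>f \<xi>\<close> does not vanish identically. Since pairwise orthogonal nonzero vectors are
  independent, there is a largest \<open>k\<close> for which the \<open>k\<close>-th frame is free of zeros at some point \<open>q\<close>.
  At every such point the span \<open>S\<close> of the frame is invariant under \<open>f\<^sup>2\<close>, because the next field
  vanishes. The residue \<open>V\<close> of \<open>\<xi>\<close> is orthogonal to \<open>S\<close>, and \<open>f\<^sup>2 V\<close> lies in \<open>S\<close>, so
  \<open>|f V|\<^sup>2 = - g V (f\<^sup>2 V) = 0\<close>. At the other points \<open>V\<close> itself is zero, thus \<open>f V = 0\<close> everywhere and
  \<open>V\<close> is a multiple of \<open>\<xi>\<close>. If \<open>V\<close> were zero at \<open>q\<close>, then \<open>\<xi>\<close> would lie in \<open>S\<close> and be orthogonal to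
  the kernel of \<open>f\<close>, which contains a vector \<open>v\<close> with \<open>\<eta>(v) \<noteq> 0\<close>. Hence \<open>f \<xi> = 0\<close> at \<open>q\<close>, although
  \<open>f\<^sup>2 \<xi>\<close> is a field of the frame and does not vanish there.\<close>

lemma f_xi [simp]: "f p (\<xi> p) = 0"
proof (rule ccontr)
  define nz where "nz k p \<longleftrightarrow> (\<forall>Y\<in>set (krylov k). Y p \<noteq> 0)" for k p
  have start: "f q (f q (\<xi> q)) = 0 \<longleftrightarrow> f q (\<xi> q) = 0" for q
    using g_f_f[of "\<xi> q" q "\<xi> q"] by (auto simp: f_lin g_lin g_eq_0_iff)
  assume "f p (\<xi> p) \<noteq> 0"
  then have "nz 0 p" using start by (simp add: nz_def krylov_0 act_def)
  then have ex: "\<exists>p. nz 0 p" by blast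
  have bound: "k \<le> DIM('b)" if "\<exists>p. nz k p" for k
    using that krylov_nonvanishing_bound Suc_leD unfolding nz_def by blast
  define k where "k = (GREATEST k. \<exists>p. nz k p)"
  obtain q where q: "nz k q" using GreatestI_nat[of "\<lambda>k. \<exists>p. nz k p", OF ex bound] by (auto simp: k_def)
  have "\<not> nz (Suc k) r" for r
    using Greatest_le_nat[of "\<lambda>k. \<exists>p. nz k p" "Suc k" "DIM('b)"] bound by (auto simp: k_def)
  then have next0: "orthogonal_residue g (krylov k) (f \<cdot> f \<cdot> hd (krylov k)) r = 0" if "nz k r" for r
    using that by (auto simp: nz_def krylov_Suc)
  define V where "V = orthogonal_residue g (krylov k) \<xi>"
  have V: "V \<in> fields" by (simp add: V_def residue_field krylov_fields)
  have V_decomp: "\<exists>c. c \<noteq> 0 \<and> V r - c *\<^sub>R \<xi> r \<in> span (krylov_values k r)" if "nz k r" for r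
    using residue_span[of "krylov k" \<xi> r] krylov_fields that
    unfolding V_def nz_def krylov_values_def by (metis xi_field)
  have "f r (V r) = 0" for r
  proof (cases "nz k r")
    case True
    let ?S = "span (krylov_values k r)"
    \<comment> \<open>The newest vector is zero, so \<open>krylov_image\<close> lands in \<open>?S\<close> itself.\<close>
    have vals: "krylov_values (Suc k) r = insert 0 (krylov_values k r)"
      using next0[OF True] by (simp add: krylov_values_def krylov_Suc)
    have "krylov_values k r \<subseteq> {u \<in> T r. f r (f r u) \<in> ?S}"
      using krylov_image[of k r] True krylov_values_T[of k r] vals
      by (auto simp: nz_def krylov_values_def span_insert_0)
    moreover have "subspace {u \<in> T r. f r (f r u) \<in> ?S}"
      by (auto simp: subspace_def f_lin span_zero span_add span_scale)
    ultimately have inv: "?S \<subseteq> {u \<in> T r. f r (f r u) \<in> ?S}" by (rule span_minimal)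
    obtain c where "V r - c *\<^sub>R \<xi> r \<in> ?S" using V_decomp[OF True] by blast
    then have "f r (f r (V r - c *\<^sub>R \<xi> r)) \<in> ?S" using inv by blast
    then have "f r (f r (V r)) - c *\<^sub>R f r (f r (\<xi> r)) \<in> ?S" using V by (simp add: f_lin)
    moreover have "f r (f r (\<xi> r)) \<in> ?S"
      using krylov_start[of k] by (auto simp: krylov_values_def act_def image_iff intro!: span_base bexI)
    ultimately have "f r (f r (V r)) - c *\<^sub>R f r (f r (\<xi> r)) + c *\<^sub>R f r (f r (\<xi> r)) \<in> ?S"
      by (intro span_add span_scale)
    then have "f r (f r (V r)) \<in> ?S" by simp
    then have "g r (V r) (f r (f r (V r))) = 0"
    proof (rule g_span_eq_0[rotated 3])
      show "V r \<in> T r" using V by simp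
      show "krylov_values k r \<subseteq> T r" by (rule krylov_values_T)
      fix u assume "u \<in> krylov_values k r"
      then obtain Y where "Y \<in> set (krylov k)" "u = Y r" unfolding krylov_values_def by blast
      then show "g r (V r) u = 0"
        using residue_orthogonal[OF krylov_fields xi_field krylov_orthogonal] by (simp add: V_def)
    qed
    then have "g r (f r (V r)) (f r (V r)) = 0" using V by (simp add: g_f_f)
    then show ?thesis using V by (simp add: g_eq_0_iff)
  next
    case False
    then have "V r = 0"
      using residue_eq_0[OF krylov_fields xi_field] unfolding V_def nz_def by blast
    then show ?thesis by (simp add: f_lin)
  qed
  then have "f \<cdot> V = 0" by (simp add: fun_eq_iff act_def)
  with V have Vq: "V q = \<eta> q (V q) *\<^sub>R \<xi> q" by (rule annihilated_field_parallel)
  have "V q \<noteq> 0"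
  proof
    assume "V q = 0"
    obtain c where c: "c \<noteq> 0" "V q - c *\<^sub>R \<xi> q \<in> span (krylov_values k q)" using V_decomp[OF q] by blast
    then have "(- inverse c) *\<^sub>R (V q - c *\<^sub>R \<xi> q) \<in> span (krylov_values k q)" by (intro span_scale)
    then have xi: "\<xi> q \<in> span (krylov_values k q)" using c \<open>V q = 0\<close> by simp
    obtain v where v: "v \<in> T q" "v \<noteq> 0" "f q v = 0" by (rule kernel_f_nontrivial)
    have "g q v (\<xi> q) = 0" by (rule krylov_orthogonal_kernel[OF v(1,3) xi])
    then have "\<eta> q v = 0" using v by (simp add: eta_g g_sym)
    then show False using kernel_f(2)[of v q] v by blast
  qed
  then have c: "\<eta> q (V q) \<noteq> 0" using Vq by auto
  have "\<eta> q (V q) *\<^sub>R f q (\<xi> q) = f q (\<eta> q (V q) *\<^sub>R \<xi> q)" by (simp add: f_lin)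
  also have "\<dots> = 0" using \<open>\<And>r. f r (V r) = 0\<close>[of q] Vq by simp
  finally have "f q (\<xi> q) = 0" using c by simp
  then have "(f \<cdot> f \<cdot> \<xi>) q = 0" by (simp add: act_def f_lin)
  then show False using q krylov_start[of k] by (auto simp: nz_def)
qed

section \<open>Structure equations\<close>

text \<open>The component of a vector field along \<open>\<xi>\<close>.\<close>

abbreviation vertical :: "'a vfield \<Rightarrow> 'a vfield" where "vertical X \<equiv> (\<eta> \<cdot> X) \<odot> \<xi>"

lemma apply_field [simp]:
  "(f \<cdot> X) p = f p (X p)" "(Q \<cdot> X) p = Q p (X p)" "vertical X p = \<eta> p (X p) *\<^sub>R \<xi> p"
  by (simp_all add: act_def scale_by_def)

lemma f_zero [simp]: "f \<cdot> 0 = 0"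
  by (rule f_field_lin(4)[OF xi_field xi_field])

lemma scale_by_zero [simp]: "u \<odot> (0 :: 'a vfield) = 0"
  by (rule ext) (simp add: scale_by_def)

lemma g_xi: "u \<in> T p \<Longrightarrow> g p (\<xi> p) u = \<eta> p u" "u \<in> T p \<Longrightarrow> g p u (\<xi> p) = \<eta> p u"
  by (simp_all add: eta_g g_sym)

lemma vertical_lin:
  assumes "X \<in> fields" "Y \<in> fields"
  shows "vertical (X + Y) = vertical X + vertical Y" "vertical (X - Y) = vertical X - vertical Y" "vertical (- X) = - vertical X"
proof -
  have pt: "(U + V) p = U p + V p" "(U - V) p = U p - V p" "(- U) p = - U p"
    for U V :: "'a vfield" and p by simp_all
  show "vertical (X + Y) = vertical X + vertical Y" "vertical (X - Y) = vertical X - vertical Y" "vertical (- X) = - vertical X"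
    by (rule ext, simp only: pt apply_field,
        simp only: eta_lin T_closed assms scaleR_add_left scaleR_diff_left scaleR_minus_left)+
qed

lemma xi_kernel [simp]: "f \<cdot> \<xi> = 0"
  by (rule ext) simp

lemma f_vertical [simp]: "X \<in> fields \<Longrightarrow> f \<cdot> vertical X = 0"
  by (rule ext) (simp add: f_lin)

lemma eta_f [simp]: "u \<in> T p \<Longrightarrow> \<eta> p (f p u) = 0"
  using f_skew[of "\<xi> p" p u] by (simp add: eta_g g_lin)

lemma vertical_f [simp]: "X \<in> fields \<Longrightarrow> vertical (f \<cdot> X) = 0"
  by (rule ext) simp

lemma g_xi_xi: "g p (\<xi> p) (\<xi> p) = 1"
  using eta_g[of "\<xi> p" p] by simp

lemma h_xi [simp]: "h \<xi> = 0"
  by (simp add: tensor_h_def lie_deriv_def lie_bracket_eq nabla_zero f_field_lin[OF xi_field xi_field])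

lemma D_zero: "X \<in> fields \<Longrightarrow> D X 0 = 0" "X \<in> fields \<Longrightarrow> D 0 X = 0"
  by (simp_all add: cov_deriv_def nabla_zero f_field_lin[OF xi_field xi_field])

lemma contact_at:
  assumes "X \<in> fields" "Y \<in> fields"
  shows "D X Y p + D (f \<cdot> X) (f \<cdot> Y) p = (2 * g p (X p) (Y p)) *\<^sub>R \<xi> p
    - \<eta> p (Y p) *\<^sub>R (X p + h X p + \<eta> p (X p) *\<^sub>R \<xi> p)"
proof -
  have "(D X Y + D (f \<cdot> X) (f \<cdot> Y)) p =
      ((2 *\<^sub>R metric_fun g X Y) \<odot> \<xi> - (\<eta> \<cdot> Y) \<odot> (X + h X + vertical X)) p"
    by (simp only: contact_condition[OF assms])
  moreover have "((2 *\<^sub>R metric_fun g X Y) \<odot> \<xi>) p = (2 * g p (X p) (Y p)) *\<^sub>R \<xi> p"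
    by (simp add: scale_by_def scaleR_fun_def metric_fun_def)
  moreover have "((\<eta> \<cdot> Y) \<odot> Z) p = \<eta> p (Y p) *\<^sub>R Z p" for Z :: "'a vfield"
    by (simp add: scale_by_def act_def)
  ultimately show ?thesis by simp
qed

text \<open>The contact condition for \<open>X = \<xi>\<close>, where \<open>f \<xi> = 0\<close> and \<open>h \<xi> = 0\<close>.\<close>

lemma f_parallel_along_xi:
  assumes "X \<in> fields" shows "D \<xi> X = 0"
proof
  fix p
  have "D \<xi> X p = (2 * \<eta> p (X p)) *\<^sub>R \<xi> p - \<eta> p (X p) *\<^sub>R (2 *\<^sub>R \<xi> p)"
    using contact_at[OF xi_field assms, of p] assms
    by (simp add: D_zero g_xi flip: scaleR_2)
  then show "D \<xi> X p = 0 p" by simp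
qed

text \<open>The contact condition for \<open>Y = \<xi>\<close>, where \<open>(\<nabla>\<^sub>X f) \<xi> = - f (\<nabla>\<^sub>X \<xi>)\<close>.\<close>

lemma f_nabla_xi:
  assumes "X \<in> fields" shows "f \<cdot> nabla X \<xi> = X + h X - vertical X"
proof
  fix p
  have gx: "g p (X p) (\<xi> p) = \<eta> p (X p)" using assms by (simp add: eta_g g_sym)
  have "D X \<xi> p = - f p (nabla X \<xi> p)" using assms by (simp add: cov_deriv_def nabla_zero)
  then have "f p (nabla X \<xi> p) = X p + h X p + \<eta> p (X p) *\<^sub>R \<xi> p - (2 * \<eta> p (X p)) *\<^sub>R \<xi> p"
    using contact_at[OF assms xi_field, of p] assms
    by (simp add: D_zero gx) (metis (no_types) add.inverse_inverse minus_diff_eq)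
  also have "\<dots> = X p + h X p - \<eta> p (X p) *\<^sub>R \<xi> p"
    by (simp add: algebra_simps flip: scaleR_2 scaleR_scaleR)
  finally show "(f \<cdot> nabla X \<xi>) p = (X + h X - vertical X) p" by simp
qed

text \<open>Differentiate \<open>g \<xi> \<xi> = 1\<close>.\<close>

lemma eta_nabla_xi [simp]:
  assumes "X \<in> fields" shows "\<eta> p (nabla X \<xi> p) = 0"
proof -
  have "metric_fun g \<xi> \<xi> = (\<lambda>p. 1)" by (simp add: fun_eq_iff metric_fun_def g_xi_xi)
  then have "g p (nabla X \<xi> p) (\<xi> p) + g p (\<xi> p) (nabla X \<xi> p) = 0"
    using metric_compatible[OF assms xi_field xi_field, of p] field_one[OF assms, of p] by simp
  then show ?thesis using assms g_sym[of "nabla X \<xi> p" p "\<xi> p"] by (simp add: eta_g)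
qed

lemma vertical_nabla_xi [simp]: "X \<in> fields \<Longrightarrow> vertical (nabla X \<xi>) = 0"
  by (rule ext) simp

lemma kernel_f_eta:
  assumes "u \<in> T p" "f p u = 0" "\<eta> p u = 0" shows "u = 0"
  using kernel_f(2)[OF assms(1,2)] assms(3) by blast

lemma xi_geodesic: "nabla \<xi> \<xi> = 0"
proof
  fix p
  have "(f \<cdot> nabla \<xi> \<xi>) p = 0" unfolding f_nabla_xi[OF xi_field] by simp
  then show "nabla \<xi> \<xi> p = 0 p" using kernel_f_eta[of "nabla \<xi> \<xi> p" p] by simp
qed

lemma eta_h [simp]:
  assumes "X \<in> fields" shows "\<eta> p (h X p) = 0"
proof -
  have "\<eta> p ((f \<cdot> nabla X \<xi>) p) = \<eta> p ((X + h X - vertical X) p)" by (simp only: f_nabla_xi[OF assms])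
  then show ?thesis using assms by (simp add: eta_lin)
qed

text \<open>Without torsion \<open>2 h X = (\<nabla>\<^sub>\<xi> f) X - \<nabla>\<^bsub>fX\<^esub> \<xi> + f (\<nabla>\<^sub>X \<xi>)\<close>, where the first term is zero and the last is
  known.\<close>

lemma nabla_f_xi:
  assumes "X \<in> fields" shows "nabla (f \<cdot> X) \<xi> = X - h X - vertical X"
proof -
  have "2 *\<^sub>R h X = D \<xi> X - nabla (f \<cdot> X) \<xi> + f \<cdot> nabla X \<xi>"
    using assms by (simp add: h_eq lie_bracket_eq cov_deriv_def f_field_lin)
  then have "nabla (f \<cdot> X) \<xi> = f \<cdot> nabla X \<xi> - (h X + h X)"
    using f_parallel_along_xi[OF assms] by (simp add: scaleR_2 algebra_simps)
  then show ?thesis using f_nabla_xi[OF assms] by (simp add: algebra_simps)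
qed

text \<open>Compute \<open>f (\<nabla>\<^bsub>fX\<^esub> \<xi>)\<close> by \<open>f_nabla_xi\<close> and by \<open>nabla_f_xi\<close>.\<close>

lemma h_anticommutes:
  assumes "X \<in> fields" shows "f \<cdot> h X = - h (f \<cdot> X)"
proof -
  have "f \<cdot> (X - h X - vertical X) = f \<cdot> X + h (f \<cdot> X)"
    using f_nabla_xi[of "f \<cdot> X"] nabla_f_xi assms by simp
  then have "f \<cdot> X - f \<cdot> h X = f \<cdot> X + h (f \<cdot> X)" using assms by (simp add: f_field_lin)
  then show ?thesis by (simp add: eq_neg_iff_add_eq_0 algebra_simps)
qed

text \<open>Pair the contact condition for \<open>X, Y\<close> with \<open>\<xi>\<close> and move \<open>\<nabla> f\<close> to \<open>\<xi>\<close> by skew-symmetry. The two terms on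
  the left become \<open>g Y (X + h X - E X)\<close> and \<open>g (f Y) (f (X - h X))\<close>, where \<open>E X\<close> is the vertical part of
  \<open>X\<close>, and the second one contains \<open>Q\<close>. Comparison with the right side leaves
  \<open>g Y (Q (X - h X)) = g Y (X - h X)\<close>, and \<open>Y\<close> may be the difference \<open>Z\<close> of the two fields itself.\<close>

lemma Q_fixes_diff:
  assumes "X \<in> fields" shows "Q \<cdot> (X - h X) = X - h X"
proof
  fix p
  define Z where "Z = Q \<cdot> (X - h X) - (X - h X)"
  have Z: "Z \<in> fields" using assms by (simp add: Z_def)
  have xs: "X p \<in> T p" "h X p \<in> T p" "\<xi> p \<in> T p" "Z p \<in> T p" using assms Z by simp_all
  let ?z = "Z p"
  have Df: "D U \<xi> p = - (f \<cdot> nabla U \<xi>) p" if "U \<in> fields" for U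
    using that by (simp add: cov_deriv_def nabla_zero)
  have "g p (D X Z p) (\<xi> p) = g p ?z (X p + h X p - \<eta> p (X p) *\<^sub>R \<xi> p)"
    using D_skew[OF assms Z xi_field, of p] xs
    unfolding Df[OF assms] f_nabla_xi[OF assms] by (simp add: g_lin)
  moreover have "g p (D (f \<cdot> X) (f \<cdot> Z) p) (\<xi> p) = g p (f p ?z) (f p (X p - h X p))"
    using D_skew[of "f \<cdot> X" "f \<cdot> Z" \<xi> p] assms Z xs
    unfolding Df[OF fields_f_Q(1)[OF assms]] by (simp add: nabla_f_xi g_lin f_lin)
  moreover have "g p (f p ?z) (f p (X p - h X p)) =
      g p ?z (Q p (X p - h X p)) - \<eta> p ?z * \<eta> p (X p)"
    using assms xs by (simp add: g_ff_Q eta_lin)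
  moreover have "g p (D X Z p + D (f \<cdot> X) (f \<cdot> Z) p) (\<xi> p) =
      2 * g p (X p) ?z - \<eta> p ?z * (\<eta> p (X p) + \<eta> p (X p))"
  proof -
    have "g p u (\<xi> p) = \<eta> p u" if "u \<in> T p" for u using that by (simp add: eta_g g_sym)
    then show ?thesis
      unfolding contact_at[OF assms Z] using assms xs by (simp add: g_lin eta_lin)
  qed
  moreover have "g p (D X Z p + D (f \<cdot> X) (f \<cdot> Z) p) (\<xi> p) =
      g p (D X Z p) (\<xi> p) + g p (D (f \<cdot> X) (f \<cdot> Z) p) (\<xi> p)"
    using assms Z by (simp add: g_lin)
  moreover have "g p ?z (\<xi> p) = \<eta> p ?z" using xs by (simp add: eta_g g_sym)
  ultimately have "g p ?z (Q p (X p - h X p)) - g p ?z (X p - h X p) = 0"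
    using xs g_sym[of ?z p "X p"] by (simp add: g_lin algebra_simps)
  then have "g p ?z (Q p (X p - h X p) - (X p - h X p)) = 0" using xs by (simp add: g_lin)
  then have "g p ?z ?z = 0" by (simp add: Z_def)
  then have "?z = 0" using xs by (simp add: g_eq_0_iff)
  then show "(Q \<cdot> (X - h X)) p = (X - h X) p" by (simp add: Z_def)
qed

text \<open>For \<open>f X\<close> instead of \<open>X\<close>, anticommutation turns the previous lemma into \<open>Q (f V) = f V\<close> with
  \<open>V = X + h X\<close>. Since \<open>f\<close> commutes with \<open>Q\<close> and is injective on the kernel of \<open>\<eta>\<close>, also \<open>Q V = V\<close>, and
  \<open>X\<close> is the mean of \<open>X + h X\<close> and \<open>X - h X\<close>.\<close>

lemma Q_fixes_fields:
  assumes "X \<in> fields" shows "Q p (X p) = X p"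
proof -
  have xs [simp]: "X p \<in> T p" "h X p \<in> T p" using assms by simp_all
  let ?v = "X p + h X p"
  have "(Q \<cdot> (f \<cdot> X - h (f \<cdot> X))) p = (f \<cdot> X - h (f \<cdot> X)) p"
    using Q_fixes_diff[of "f \<cdot> X"] assms by simp
  moreover have "h (f \<cdot> X) p = - f p (h X p)"
    using fun_cong[OF h_anticommutes[OF assms], of p] by simp
  ultimately have Qf: "Q p (f p ?v) = f p ?v" by (simp add: f_lin)
  have "f p (f p (f p ?v)) = - Q p (f p ?v)" using f_squared[of "f p ?v" p] by simp
  moreover have "f p (- Q p ?v + \<eta> p ?v *\<^sub>R \<xi> p) = - f p (Q p ?v)"
    by (simp only: f_lin T_closed xs xi_field f_xi) simp
  then have "f p (f p (f p ?v)) = - f p (Q p ?v)"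
    by (simp only: f_squared[of ?v p] T_closed xs)
  ultimately have "f p (Q p ?v - ?v) = 0" using Qf by (simp add: f_lin(5))
  moreover have "\<eta> p (Q p ?v) = \<eta> p ?v"
    using g_ff_Q[of "\<xi> p" p ?v] by (simp add: eta_g[of "Q p ?v"] g_lin)
  ultimately have "Q p ?v - ?v = 0" using kernel_f_eta[of "Q p ?v - ?v" p] by (simp add: eta_lin(5))
  moreover have "Q p (X p - h X p) = X p - h X p"
    using fun_cong[OF Q_fixes_diff[OF assms], of p] by simp
  ultimately have "Q p ?v + Q p (X p - h X p) = ?v + (X p - h X p)" by simp
  then have "2 *\<^sub>R Q p (X p) = 2 *\<^sub>R X p" by (simp add: Q_lin scaleR_2)
  then show ?thesis by simp
qed

lemma f_squared_field:
  assumes "X \<in> fields" shows "f \<cdot> f \<cdot> X = vertical X - X"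
  by (rule ext) (use assms in \<open>simp add: f_squared Q_fixes_fields\<close>)

lemma nabla_xi:
  assumes "X \<in> fields" shows "nabla X \<xi> = h (f \<cdot> X) - f \<cdot> X"
proof -
  have "f \<cdot> f \<cdot> nabla X \<xi> = f \<cdot> (X + h X - vertical X)" using f_nabla_xi[OF assms] by simp
  then have "- nabla X \<xi> = f \<cdot> X + f \<cdot> h X"
    using assms by (simp add: f_squared_field f_field_lin)
  then show ?thesis using h_anticommutes[OF assms] by (simp add: algebra_simps)
qed

lemma h_eq_f_nabla_xi:
  assumes "X \<in> fields" shows "h X = f \<cdot> nabla X \<xi> - X + vertical X"
  using f_nabla_xi[OF assms] by simp

lemma h_lin:
  assumes "X \<in> fields" "Y \<in> fields"
  shows "h (X + Y) = h X + h Y" "h (X - Y) = h X - h Y" "h (- X) = - h X"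
  using assms by (simp_all add: h_eq_f_nabla_xi nabla_add nabla_diff nabla_minus f_field_lin vertical_lin)

lemma h_vertical:
  assumes "X \<in> fields" shows "h (vertical X) = 0"
proof -
  have "vertical (vertical X) = vertical X" using assms by (intro ext) (simp add: eta_lin)
  then show ?thesis
    using assms by (simp add: h_eq_f_nabla_xi nabla_scale_by xi_geodesic scale_by_def[of "\<eta> \<cdot> X" 0] flip: zero_fun_def)
qed

text \<open>The Leibniz rule and \<open>\<xi>(\<eta>(X)) = \<eta>(\<nabla>\<^sub>\<xi> X)\<close>, both with \<open>\<nabla>\<^sub>\<xi> \<xi> = 0\<close>.\<close>

lemma nabla_xi_vertical:
  assumes "X \<in> fields" shows "nabla \<xi> (vertical X) = vertical (nabla \<xi> X)"
proof -
  have "\<xi> p (\<eta> \<cdot> X) = \<eta> p (nabla \<xi> X p)" for p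
  proof -
    have "\<eta> \<cdot> X = metric_fun g \<xi> X"
      using assms by (simp add: fun_eq_iff act_def metric_fun_def eta_g)
    then show ?thesis
      using metric_compatible[OF xi_field xi_field assms, of p] assms
      by (simp add: xi_geodesic g_lin eta_g)
  qed
  then have "(\<lambda>p. \<xi> p (\<eta> \<cdot> X)) = \<eta> \<cdot> nabla \<xi> X" by (simp add: fun_eq_iff act_def)
  then show ?thesis
    using assms nabla_scale_by(2)[OF xi_field xi_field, of "\<eta> \<cdot> X"] by (simp add: xi_geodesic)
qed

section \<open>Curvature identities\<close>

lemma curvature_field [simp]:
  "X \<in> fields \<Longrightarrow> Y \<in> fields \<Longrightarrow> Z \<in> fields \<Longrightarrow> curvature A nabla X Y Z \<in> fields"
  by (simp add: curvature_def lie_bracket_eq)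

lemma jacobi_operator:
  assumes "X \<in> fields"
  shows "curvature A nabla X \<xi> \<xi> =
    nabla (nabla \<xi> X) \<xi> - nabla \<xi> (nabla X \<xi>) - nabla (nabla X \<xi>) \<xi>"
  using assms by (simp add: curvature_def lie_bracket_eq nabla_diff xi_geodesic nabla_zero)

text \<open>Apply \<open>f\<close> to the three terms of \<open>R\<^bsub>X,\<xi>\<^esub> \<xi>\<close>. In the term \<open>\<nabla>\<^sub>\<xi> (\<nabla>\<^sub>X \<xi>)\<close> it passes through \<open>\<nabla>\<^sub>\<xi>\<close>, and
  \<open>f_nabla_xi\<close> then evaluates all of them; the derivatives of \<open>X\<close> along \<open>\<xi>\<close> cancel.\<close>

lemma cov_deriv_h:
  assumes "X \<in> fields"
  shows "cov_deriv nabla \<xi> h X = f \<cdot> X - h (h (f \<cdot> X)) - f \<cdot> curvature A nabla X \<xi> \<xi>"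
proof -
  let ?N = "nabla X \<xi>"
  have 1: "f \<cdot> nabla \<xi> ?N = nabla \<xi> X + nabla \<xi> (h X) - vertical (nabla \<xi> X)"
  proof -
    have "f \<cdot> nabla \<xi> ?N = nabla \<xi> (f \<cdot> ?N)"
      using f_parallel_along_xi[of ?N] assms by (simp add: cov_deriv_def)
    then show ?thesis using assms by (simp add: f_nabla_xi nabla_add nabla_diff nabla_xi_vertical)
  qed
  have 2: "?N + h ?N = h (h (f \<cdot> X)) - f \<cdot> X"
    using assms by (simp add: nabla_xi h_lin)
  have "f \<cdot> curvature A nabla X \<xi> \<xi> =
      f \<cdot> nabla (nabla \<xi> X) \<xi> - f \<cdot> nabla \<xi> ?N - f \<cdot> nabla ?N \<xi>"
    using assms by (simp add: jacobi_operator f_field_lin)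
  also have "\<dots> = h (nabla \<xi> X) - nabla \<xi> (h X) - (?N + h ?N)"
    using assms by (simp add: 1 f_nabla_xi)
  finally show ?thesis unfolding 2 by (simp add: cov_deriv_def)
qed

text \<open>Differentiate \<open>g (\<nabla>\<^sub>X \<xi>) \<xi> = 0\<close> along the geodesic field \<open>\<xi>\<close>; the other two terms of the curvature
  are derivatives of \<open>\<xi>\<close>.\<close>

lemma eta_jacobi_operator:
  assumes "X \<in> fields" shows "\<eta> p (curvature A nabla X \<xi> \<xi> p) = 0"
proof -
  \<comment> \<open>Written with the zero field, the function \<open>0\<close> can be differentiated by metric compatibility.\<close>
  have "metric_fun g (nabla X \<xi>) \<xi> = metric_fun g 0 \<xi>"
    using assms by (simp add: fun_eq_iff metric_fun_def g_xi eta_lin)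
  then have "g p (nabla \<xi> (nabla X \<xi>) p) (\<xi> p) = 0"
    using metric_compatible[of \<xi> "nabla X \<xi>" \<xi> p] metric_compatible[of \<xi> 0 \<xi> p] assms
    by (simp add: xi_geodesic nabla_zero g_lin)
  then have "\<eta> p (nabla \<xi> (nabla X \<xi>) p) = 0" using assms by (simp add: g_xi)
  then show ?thesis using assms by (simp add: jacobi_operator eta_lin)
qed

text \<open>As \<open>R\<^bsub>X,\<xi>\<^esub> \<xi>\<close> is orthogonal to \<open>\<xi>\<close>, it equals \<open>- f\<^sup>2 R\<^bsub>X,\<xi>\<^esub> \<xi>\<close>. So \<open>cov_deriv_h\<close> determines both curvature
  terms, the first after another application of \<open>f\<close> and the second with \<open>f X\<close> in place of \<open>X\<close>.\<close>

lemma jacobi_operator_relation: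
  assumes "X \<in> fields"
  shows "curvature A nabla \<xi> X \<xi> - f \<cdot> curvature A nabla \<xi> (f \<cdot> X) \<xi> =
    2 *\<^sub>R h (h X) + (f \<cdot> f \<cdot> X + f \<cdot> f \<cdot> X)"
proof -
  let ?R = "\<lambda>X. curvature A nabla X \<xi> \<xi>" and ?C = "cov_deriv nabla \<xi> h"
  have swap: "curvature A nabla \<xi> Y \<xi> = - ?R Y" if "Y \<in> fields" for Y
    using that by (simp add: curvature_def lie_bracket_eq nabla_diff)
  have "vertical (?R X) = 0" using eta_jacobi_operator[OF assms] by (intro ext) simp
  then have "- ?R X = f \<cdot> f \<cdot> ?R X" using assms by (simp add: f_squared_field)
  also have "\<dots> = f \<cdot> (f \<cdot> X - h (h (f \<cdot> X)) - ?C X)"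
    using cov_deriv_h[OF assms] by simp
  also have "\<dots> = f \<cdot> f \<cdot> X - h (h (f \<cdot> f \<cdot> X)) - f \<cdot> ?C X"
    using assms by (simp add: f_field_lin h_anticommutes h_lin cov_deriv_def)
  finally have 1: "- ?R X = f \<cdot> f \<cdot> X - h (h (f \<cdot> f \<cdot> X)) - f \<cdot> ?C X" .
  have 2: "f \<cdot> ?R (f \<cdot> X) = f \<cdot> f \<cdot> X - h (h (f \<cdot> f \<cdot> X)) - ?C (f \<cdot> X)"
    using cov_deriv_h[of "f \<cdot> X"] assms by (simp add: algebra_simps)
  have 3: "f \<cdot> ?C X = - ?C (f \<cdot> X)"
  proof -
    have comm: "f \<cdot> nabla \<xi> Y = nabla \<xi> (f \<cdot> Y)" if "Y \<in> fields" for Y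
      using f_parallel_along_xi[OF that] by (simp add: cov_deriv_def)
    show ?thesis
      using assms by (simp add: cov_deriv_def f_field_lin comm h_anticommutes nabla_minus)
  qed
  have 4: "h (h (f \<cdot> f \<cdot> X)) = - h (h X)"
    using assms by (simp add: f_squared_field h_lin h_vertical)
  show ?thesis
    using assms 1 2 3 4 by (simp add: swap f_field_lin scaleR_2 algebra_simps)
qed

lemma tensor_inv_Q:
  assumes "X \<in> fields" shows "tensor_inv A Q \<cdot> X = X"
proof
  fix p
  have "inv_into (T p) (Q p) (Q p (X p)) = X p"
    using assms Q_bij by (intro inv_into_f_f) (auto simp: bij_betw_def)
  then show "(tensor_inv A Q \<cdot> X) p = X p"
    using assms by (simp add: tensor_inv_def act_def Q_fixes_fields)
qed

lemma Q_field: "X \<in> fields \<Longrightarrow> Q \<cdot> X = X"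
  by (rule ext) (simp add: Q_fixes_fields)

end

theorem proposition1:
  fixes A :: "('a::{t2_space, second_countable_topology}, 'b::euclidean_space) chart set"
    and n :: nat
    and nabla :: "'a vfield \<Rightarrow> 'a vfield \<Rightarrow> 'a vfield"
    and f Q :: "'a tensor11" and \<xi> X :: "'a vfield" and \<eta> :: "'a form1" and g :: "'a tensor02"
  assumes "smooth_manifold (2 * n + 1) A"
    and "weak_quasi_contact_metric A nabla f Q \<xi> \<eta> g"
    and "X \<in> vector_fields A"
  shows "(cov_deriv nabla \<xi> (tensor_h A f \<xi>) X =
      tensor_inv A Q \<cdot> (f \<cdot> X - tensor_h A f \<xi> (tensor_h A f \<xi> (f \<cdot> X)))
      - f \<cdot> curvature A nabla X \<xi> \<xi>) \<and>
    (Q \<cdot> curvature A nabla \<xi> X \<xi> - f \<cdot> curvature A nabla \<xi> (f \<cdot> X) \<xi> =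
      2 *\<^sub>R tensor_h A f \<xi> (tensor_h A f \<xi> X)
      + (Q \<cdot> f \<cdot> f \<cdot> X + tensor_inv A Q \<cdot> f \<cdot> f \<cdot> X))"
proof -
  interpret weak_quasi_contact A nabla f Q \<xi> \<eta> g
    by unfold_locales (use assms(1,2) in \<open>auto simp: smooth_manifold_def\<close>)
  show ?thesis
    using assms(3) cov_deriv_h jacobi_operator_relation by (simp add: tensor_inv_Q Q_field)
qed

end
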